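(* There exists a numerical constant $C>0$ such that for every $\epsilon\in(0,1)$ and every positive integer $K$ with $K \geq C\, \frac{\log^2(1/\epsilon)}{\epsilon^4}$, one has $$\liminf_{n \to +\infty} \ \mathbb{P}\left(1 \in H_{\psi}(\mathrm{PA}(n)^{\circ})\right) \geq 1 - \epsilon.$$
   Context: Write $[n]=\{1,\dots,n\}$. The preferential attachment tree $\mathrm{PA}(n)$, $n\ge 2$, is the random labeled tree on vertex set $[n]$ defined inductively: $\mathrm{PA}(2)$ is the unique tree on two vertices, and $\mathrm{PA}(n+1)$ is obtained from $\mathrm{PA}(n)$ by adding the vertex $n+1$ and an edge $\{i,n+1\}$, where $i\in[n]$ is chosen at random with probability proportional to its degree in $\mathrm{PA}(n)$. $T^\circ$ denotes the unlabeled copy (isomorphism class) of a labeled tree $T$; vertices of $T^\circ$ are denoted using the labels of $T$. For a tree $T$ with vertex set $V(T)$ and $u\in V(T)$, let $(T,u)$ be the tree rooted at $u$, and $(T,u)_{v\downarrow}$ the subtree consisting of $v$ and all its descendants when $T$ is rooted at $u$; $|\cdot|$ is the number of vertices. Define $$\psi_T(u)=\max_{v\in V(T)\setminus\{u\}} |(T,u)_{v\downarrow}| .$$ (This does not depend on the labeling of the tree.) $H_\psi$ is the mapping which, given a tree $T$ with at least $K$ vertices, returns the set of $K$ vertices with smallest $\psi_T$ values, ties being broken arbitrarily. *)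

theory Defs
  imports "HOL-Probability.Probability"
begin

section \<open>Finite simple graphs and trees\<close>

record 'a ugraph =
  verts :: "'a set"
  edges :: "'a set set"

definition simple_graph :: "'a ugraph \<Rightarrow> bool" where
  "simple_graph G \<longleftrightarrow>
     finite (verts G) \<and> (\<forall>e\<in>edges G. e \<subseteq> verts G \<and> card e = 2)"

definition degree :: "'a ugraph \<Rightarrow> 'a \<Rightarrow> nat" where
  "degree G v = card {e \<in> edges G. v \<in> e}"

text \<open>Paths and cycles are lists of pairwise distinct vertices; the closing edge of a cycle,
  from its last to its first vertex, is not repeated in the list.\<close>

definition path :: "'a ugraph \<Rightarrow> 'a \<Rightarrow> 'a list \<Rightarrow> 'a \<Rightarrow> bool" where
  "path G u p v \<longleftrightarrow>
     p \<noteq> [] \<and> hd p = u \<and> last p = v \<and> distinct p \<and> set p \<subseteq> verts G \<and>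
     successively (\<lambda>x y. {x, y} \<in> edges G) p"

definition connected_graph :: "'a ugraph \<Rightarrow> bool" where
  "connected_graph G \<longleftrightarrow>
     verts G \<noteq> {} \<and> (\<forall>u\<in>verts G. \<forall>v\<in>verts G. \<exists>p. path G u p v)"

definition cycle :: "'a ugraph \<Rightarrow> 'a list \<Rightarrow> bool" where
  "cycle G p \<longleftrightarrow>
     length p \<ge> 3 \<and> distinct p \<and> set p \<subseteq> verts G \<and>
     successively (\<lambda>x y. {x, y} \<in> edges G) p \<and> {last p, hd p} \<in> edges G"

definition tree :: "'a ugraph \<Rightarrow> bool" where
  "tree G \<longleftrightarrow> simple_graph G \<and> connected_graph G \<and> (\<nexists>p. cycle G p)"


section \<open>Preferential attachment trees\<close>

text \<open>The vertex \<open>i\<close> of \<open>T\<close> is drawn with probability proportional to its degree.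
  (\<open>embed_pmf\<close> is meaningful only if its argument is a probability mass function;
  see \<open>pmf_degree_biased\<close>.)\<close>

definition degree_biased :: "'a ugraph \<Rightarrow> 'a pmf" where
  "degree_biased T = embed_pmf (\<lambda>i.
     if i \<in> verts T then real (degree T i) / (\<Sum>j\<in>verts T. real (degree T j)) else 0)"

definition attach_leaf :: "'a ugraph \<Rightarrow> 'a \<Rightarrow> 'a \<Rightarrow> 'a ugraph" where
  "attach_leaf T i v = \<lparr>verts = insert v (verts T), edges = insert {i, v} (edges T)\<rparr>"

text \<open>Only the values at \<open>n \<ge> 2\<close> matter; for \<open>n < 2\<close> we return the tree on two vertices
  as a default.\<close>

primrec PA :: "nat \<Rightarrow> nat ugraph pmf" where
  "PA 0 = return_pmf \<lparr>verts = {1, 2}, edges = {{1, 2}}\<rparr>"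
| "PA (Suc n) =
     (if n < 2 then return_pmf \<lparr>verts = {1, 2}, edges = {{1, 2}}\<rparr>
      else do {
        T \<leftarrow> PA n;
        i \<leftarrow> degree_biased T;
        return_pmf (attach_leaf T i (Suc n))
      })"

lemma pmf_degree_biased:
  assumes "finite (verts T)" and "(\<Sum>j\<in>verts T. degree T j) > 0"
  shows "pmf (degree_biased T) i =
    (if i \<in> verts T then real (degree T i) / (\<Sum>j\<in>verts T. real (degree T j)) else 0)"
  unfolding degree_biased_def
proof (rule pmf_embed_pmf)
  let ?s = "\<Sum>j\<in>verts T. real (degree T j)"
  let ?f = "\<lambda>i. if i \<in> verts T then real (degree T i) / ?s else 0"
  have s: "?s > 0"
    using assms(2) by (simp flip: of_nat_sum)
  show "0 \<le> ?f x" for x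
    using s by simp
  have "(\<integral>\<^sup>+ x. ennreal (?f x) \<partial>count_space UNIV) = (\<Sum>x\<in>verts T. ennreal (?f x))"
    by (rule nn_integral_count_space'[OF assms(1)]) auto
  also have "\<dots> = ennreal (\<Sum>x\<in>verts T. ?f x)"
    using s by (intro sum_ennreal) simp
  also have "(\<Sum>x\<in>verts T. ?f x) = 1"
    using s by (simp flip: sum_divide_distrib)
  finally show "(\<integral>\<^sup>+ x. ennreal (?f x) \<partial>count_space UNIV) = 1"
    by simp
qed


section \<open>Descendants and the centrality measure\<close>

text \<open>Vertex set of \<open>(T,u)\<^sub>v\<^sub>\<down>\<close>: those \<open>w\<close> for which \<open>v\<close> lies on the path from the root
  \<open>u\<close> to \<open>w\<close> (this path is unique when \<open>T\<close> is a tree).\<close>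

definition descendants :: "'a ugraph \<Rightarrow> 'a \<Rightarrow> 'a \<Rightarrow> 'a set" where
  "descendants T u v = {w \<in> verts T. \<exists>p. path T u p w \<and> v \<in> set p}"

definition psi :: "'a ugraph \<Rightarrow> 'a \<Rightarrow> nat" where
  "psi T u = Max ((\<lambda>v. card (descendants T u v)) ` (verts T - {u}))"


section \<open>Unlabeled trees and the root-finding map\<close>

definition graph_iso :: "('a \<Rightarrow> 'b) \<Rightarrow> 'a ugraph \<Rightarrow> 'b ugraph \<Rightarrow> bool" where
  "graph_iso f G G' \<longleftrightarrow>
     bij_betw f (verts G) (verts G') \<and> edges G' = (\<lambda>e. f ` e) ` edges G"

text \<open>\<open>T\<^sup>\<circ>\<close>, the isomorphism class of \<open>T\<close>.\<close>

definition unlabeled :: "nat ugraph \<Rightarrow> nat ugraph set" where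
  "unlabeled T = {T'. \<exists>f. graph_iso f T T'}"

text \<open>An isomorphism class has no vertices of its own. To speak of the vertices of \<open>T\<^sup>\<circ>\<close>, we use
  a member \<open>rep T\<^sup>\<circ>\<close> of the class, which depends on \<open>T\<^sup>\<circ>\<close> only, and an isomorphism \<open>name T\<close> from
  \<open>T\<close> onto it: the vertex of \<open>T\<^sup>\<circ>\<close> denoted by the label \<open>i\<close> of \<open>T\<close> is \<open>name T i\<close>.\<close>

definition vertex_naming ::
  "(nat ugraph set \<Rightarrow> nat ugraph) \<Rightarrow> (nat ugraph \<Rightarrow> nat \<Rightarrow> nat) \<Rightarrow> bool" where
  "vertex_naming rep name \<longleftrightarrow> (\<forall>T. tree T \<longrightarrow> graph_iso (name T) T (rep (unlabeled T)))"

text \<open>\<open>H\<close> maps every unlabeled tree with at least \<open>K\<close> vertices to a set of \<open>K\<close> of its vertices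
  with smallest \<open>psi\<close>-values. Such an \<open>H\<close> is not unique: it embodies a tie-breaking rule.\<close>

definition is_H_psi ::
  "nat \<Rightarrow> (nat ugraph set \<Rightarrow> nat ugraph) \<Rightarrow> (nat ugraph set \<Rightarrow> nat set) \<Rightarrow> bool" where
  "is_H_psi K rep H \<longleftrightarrow>
     (\<forall>T. tree T \<and> K \<le> card (verts T) \<longrightarrow>
        (let U = unlabeled T; R = rep U in
           H U \<subseteq> verts R \<and> card (H U) = K \<and>
           (\<forall>u \<in> H U. \<forall>v \<in> verts R - H U. psi R u \<le> psi R v)))"

end

theory Submission
  imports Defs
begin

text \<open>
  The proof only uses recursive trees: every vertex \<open>v \<ge> 2\<close> has exactly one smaller neighbour, its
  parent. For \<open>M \<le> n\<close> the vertices of such a tree on \<open>{1..n}\<close> are partitioned into \<open>M\<close> blocks, according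
  to the first ancestor that is at most \<open>M\<close>; the block of \<open>k \<le> M\<close> is the component of \<open>k\<close> once the edges
  between the vertices \<open>1, \<dots>, M\<close> are removed. A path can leave a block only through the vertex \<open>k\<close> after
  which the block is named, so all vertices outside the block of a vertex \<open>v > M\<close> are descendants of
  \<open>k\<close> when the tree is rooted at \<open>v\<close>. This gives \<open>psi v \<ge> n - \<bar>block of v\<bar>\<close> (\<open>psi_lower_late\<close>). For \<open>M = 2\<close>,
  on the other hand, \<open>psi 1\<close> is at most the size of the larger of the two halves
  (\<open>psi_root_upper_starlike\<close>). Hence the root beats all vertices after \<open>K\<close> as soon as neither of the two
  halves is as small as some number that bounds the sizes of all \<open>K\<close> blocks (\<open>root_beats_late_vertices\<close>), and
  then it belongs to every set of \<open>K\<close> vertices with smallest \<open>psi\<close> (\<open>root_selected\<close>).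

  Half the total degree in a block, its weight, differs from the block size by an amount that does not
  change as the tree grows, and it evolves as a Polya urn: when a vertex joins a tree with \<open>N\<close> edges, a block of weight \<open>w\<close> receives it with
  probability \<open>w / N\<close>, and \<open>w\<close> then grows by one. Two consequences are exact. For \<open>M = 2\<close> the urn starts from
  \<open>(1/2, 1/2)\<close> and its law is the discrete arcsine law (\<open>prob_block_two\<close>), whence a half is smaller than
  \<open>\<eta> n\<close> with probability \<open>O(sqrt \<eta>)\<close>; the choice \<open>\<eta> = \<epsilon>\<^sup>2 / 576\<close> makes this at most \<open>\<epsilon> / 2\<close> for
  the two halves together. For general \<open>M\<close> the
  rising factorial moments \<open>w (w + 1) \<dots> (w + p - 1)\<close> are martingales up to an explicit factor
  (\<open>expectation_weight_grow\<close>). The initial weights are the degrees in \<open>PA K\<close> divided by two, and the degrees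
  have explicit rising factorial moments as well (\<open>expectation_degree_grow\<close>). With \<open>p = 2 q\<close>, Markov's
  inequality bounds the probability of a block larger than about \<open>\<eta> n\<close> by
  \<open>2 ((8 q / \<eta>)\<^sup>2 / (K - 1)) ^ q\<close> (\<open>prob_heavy_block_PA\<close>). Taking \<open>q\<close> of the order of \<open>ln (1 / \<epsilon>)\<close>, a value of
  \<open>K\<close> of the order of \<open>q\<^sup>2 / \<eta>\<^sup>2\<close>, that is \<open>(ln (1 / \<epsilon>))\<^sup>2 / \<epsilon> ^ 4\<close>, makes this at most \<open>\<epsilon> / 2\<close>.

  When \<open>\<epsilon>\<close> is close to 1 the hypothesis on \<open>K\<close> degenerates and even \<open>K = 1\<close> has to be treated. It then
  suffices that the root is the unique minimizer of \<open>psi\<close> with probability bounded away from zero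
  (\<open>prob_root_most_central\<close>): with positive probability the tree on 13 vertices is a spider with six legs of
  length two around the root, and from there on second moments show that all seven blocks stay below
  half of the tree with probability at least \<open>1/10\<close>.
\<close>

section \<open>Isomorphism invariance and selection\<close>

lemma path_iso:
  assumes iso: "graph_iso f G G'" and p: "path G u p v"
  shows "path G' (f u) (map f p) (f v)"
proof -
  have inj: "inj_on f (verts G)" and im: "f ` verts G = verts G'"
    and E: "edges G' = (`) f ` edges G"
    using iso by (auto simp: graph_iso_def bij_betw_def)
  have "successively (\<lambda>x y. {x, y} \<in> edges G) p" using p by (simp add: path_def)
  moreover have "{f x, f y} \<in> edges G'" if "{x, y} \<in> edges G" for x y
    using imageI[OF that, of "(`) f"] by (simp add: E)
  ultimately have "successively (\<lambda>x y. {x, y} \<in> edges G') (map f p)"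
    unfolding successively_map by (auto elim: successively_mono)
  moreover have "distinct (map f p)"
    using p inj by (auto simp: path_def distinct_map intro: inj_on_subset)
  moreover have "set (map f p) \<subseteq> verts G'" using p im by (auto simp: path_def)
  ultimately show ?thesis
    using p by (simp add: path_def hd_map last_map)
qed

lemma graph_iso_inverse:
  assumes iso: "graph_iso f G G'" and G: "simple_graph G"
  shows "graph_iso (inv_into (verts G) f) G' G"
proof -
  let ?g = "inv_into (verts G) f"
  have b: "bij_betw f (verts G) (verts G')" and E: "edges G' = (`) f ` edges G"
    using iso by (auto simp: graph_iso_def)
  have inv: "?g ` f ` e = e" if "e \<in> edges G" for e
    using that G b by (force simp: simple_graph_def bij_betw_def inv_into_image_cancel)
  have "edges G = (`) ?g ` edges G'"
    unfolding E using inv by (force simp: image_image)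
  then show ?thesis
    using bij_betw_inv_into[OF b] by (simp add: graph_iso_def)
qed

lemma descendants_iso:
  assumes iso: "graph_iso f G G'" and G: "simple_graph G"
    and u: "u \<in> verts G" and v: "v \<in> verts G"
  shows "descendants G' (f u) (f v) = f ` descendants G u v"
proof -
  let ?g = "inv_into (verts G) f"
  have b: "bij_betw f (verts G) (verts G')" using iso by (auto simp: graph_iso_def)
  have gf: "?g (f x) = x" if "x \<in> verts G" for x
    using b that by (simp add: bij_betw_inv_into_left)
  have fg: "f (?g x) = x" "?g x \<in> verts G" if "x \<in> verts G'" for x
    using b that by (auto simp: bij_betw_inv_into_right bij_betw_def inv_into_into)
  note iso' = graph_iso_inverse[OF iso G]
  show ?thesis
  proof (intro equalityI subsetI)
    fix w assume "w \<in> f ` descendants G u v"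
    then show "w \<in> descendants G' (f u) (f v)"
      using path_iso[OF iso] b by (fastforce simp: descendants_def bij_betw_def)
  next
    fix w assume "w \<in> descendants G' (f u) (f v)"
    then obtain p where w: "w \<in> verts G'" and p: "path G' (f u) p w" "f v \<in> set p"
      by (auto simp: descendants_def)
    have "path G u (map ?g p) (?g w)" using path_iso[OF iso' p(1)] gf[OF u] by simp
    moreover have "v \<in> set (map ?g p)" using p(2) gf[OF v] by force
    ultimately have "?g w \<in> descendants G u v" using fg(2)[OF w] by (auto simp: descendants_def)
    then show "w \<in> f ` descendants G u v" using fg(1)[OF w] by force
  qed
qed

lemma psi_iso:
  assumes iso: "graph_iso f G G'" and G: "simple_graph G" and u: "u \<in> verts G"
  shows "psi G' (f u) = psi G u"
proof -
  have b: "bij_betw f (verts G) (verts G')" using iso by (auto simp: graph_iso_def)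
  have vs: "verts G' - {f u} = f ` (verts G - {u})"
    using b u by (auto simp: bij_betw_def inj_on_def)
  have "card (descendants G' (f u) (f v)) = card (descendants G u v)" if "v \<in> verts G" for v
    unfolding descendants_iso[OF iso G u that]
    using b by (intro card_image) (auto simp: bij_betw_def descendants_def intro: inj_on_subset)
  then show ?thesis unfolding psi_def vs image_image
    by (intro arg_cong[of _ _ Max] image_cong) auto
qed

text \<open>If the root were left out, every selected vertex would have a \<open>psi\<close>-value at most that of the
  root, hence would belong to the set \<open>S\<close> of its possible competitors, which has too few elements. The argument
  runs on the representative \<open>rep (unlabeled T)\<close>, to which \<open>psi\<close> transfers by isomorphism invariance.\<close>

lemma root_selected:
  assumes naming: "vertex_naming rep name" and H: "is_H_psi K rep H"
    and T: "tree T" and K: "K \<le> card (verts T)" and r: "r \<in> verts T"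
    and S: "finite S" "card S < K"
    and less: "\<And>v. v \<in> verts T \<Longrightarrow> v \<notin> insert r S \<Longrightarrow> psi T r < psi T v"
  shows "name T r \<in> H (unlabeled T)"
proof (rule ccontr)
  define R where "R = rep (unlabeled T)"
  assume notin: "name T r \<notin> H (unlabeled T)"
  have iso: "graph_iso (name T) T R" using naming T by (auto simp: vertex_naming_def R_def)
  then have im: "name T ` verts T = verts R" by (auto simp: graph_iso_def bij_betw_def)
  have sg: "simple_graph T" using T by (simp add: tree_def)
  have sub: "H (unlabeled T) \<subseteq> verts R" and c: "card (H (unlabeled T)) = K"
    and min: "\<And>u v. u \<in> H (unlabeled T) \<Longrightarrow> v \<in> verts R - H (unlabeled T) \<Longrightarrow> psi R u \<le> psi R v"
    using H T K by (auto simp: is_H_psi_def Let_def R_def)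
  have "H (unlabeled T) \<subseteq> name T ` S"
  proof
    fix u assume u: "u \<in> H (unlabeled T)"
    then obtain i where i: "i \<in> verts T" "u = name T i" using sub im by blast
    have "psi R u \<le> psi R (name T r)" using u notin r im by (intro min) auto
    then have "psi T i \<le> psi T r" using psi_iso[OF iso sg] i r by simp
    moreover have "i \<noteq> r" using i u notin by auto
    ultimately show "u \<in> name T ` S" using less[of i] i by fastforce
  qed
  then have "K \<le> card S" using c S by (metis card_image_le card_mono finite_imageI le_trans)
  then show False using S by simp
qed

section \<open>Recursive trees\<close>

inductive rec_tree :: "nat \<Rightarrow> nat ugraph \<Rightarrow> bool" where
  two: "rec_tree 2 \<lparr>verts = {1, 2}, edges = {{1, 2}}\<rparr>"
| attach: "rec_tree n T \<Longrightarrow> i \<in> {1..n} \<Longrightarrow> rec_tree (Suc n) (attach_leaf T i (Suc n))"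

lemma verts_attach [simp]: "verts (attach_leaf T i v) = insert v (verts T)"
  and edges_attach [simp]: "edges (attach_leaf T i v) = insert {i, v} (edges T)"
  by (simp_all add: attach_leaf_def)

lemma rec_tree_ge2: "rec_tree n T \<Longrightarrow> 2 \<le> n"
  by (induction rule: rec_tree.induct) auto

lemma rec_tree_verts: "rec_tree n T \<Longrightarrow> verts T = {1..n}"
proof (induction rule: rec_tree.induct)
  case two then show ?case by (simp add: atLeastAtMost_insertL[symmetric] numeral_2_eq_2)
next
  case (attach n T i) then show ?case by (simp add: atLeastAtMostSuc_conv)
qed

lemma rec_tree_edge:
  "rec_tree n T \<Longrightarrow> e \<in> edges T \<Longrightarrow> \<exists>u v. e = {u, v} \<and> 1 \<le> u \<and> u < v \<and> v \<le> n"
proof (induction rule: rec_tree.induct)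
  case two then show ?case by (intro exI[of _ 1] exI[of _ 2]) auto
next
  case (attach n T i)
  show ?case
  proof (cases "e = {i, Suc n}")
    case True
    then show ?thesis using attach.hyps(2) by (intro exI[of _ i] exI[of _ "Suc n"]) auto
  next
    case False
    then have "e \<in> edges T" using attach.prems by simp
    then show ?thesis using attach.IH le_SucI by blast
  qed
qed

lemma rec_tree_edge_bound: "rec_tree n T \<Longrightarrow> e \<in> edges T \<Longrightarrow> x \<in> e \<Longrightarrow> x \<le> n"
  using rec_tree_edge by fastforce

lemma rec_tree_finite_edges: "rec_tree n T \<Longrightarrow> finite (edges T)"
  by (induction rule: rec_tree.induct) auto

lemma rec_tree_unique_parent:
  "rec_tree n T \<Longrightarrow> v \<in> {2..n} \<Longrightarrow> \<exists>!u. u < v \<and> {u, v} \<in> edges T"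
proof (induction arbitrary: v rule: rec_tree.induct)
  case two then show ?case by (auto simp: doubleton_eq_iff)
next
  case (attach n T i)
  show ?case
  proof (cases "v = Suc n")
    case True
    have "{u, v} \<notin> edges T" for u
      using rec_tree_edge_bound[OF attach.hyps(1), of "{u, v}" v] True by auto
    then have "{u, v} \<in> edges (attach_leaf T i (Suc n)) \<longleftrightarrow> u = i" for u
      using True attach.hyps(2) by (auto simp: doubleton_eq_iff)
    then show ?thesis using True attach.hyps(2) by auto
  next
    case False
    then have "\<And>u. u < v \<Longrightarrow> {u, v} \<in> edges (attach_leaf T i (Suc n)) \<longleftrightarrow> {u, v} \<in> edges T"
      using attach.prems by (auto simp: doubleton_eq_iff)
    then have "(\<lambda>u. u < v \<and> {u, v} \<in> edges (attach_leaf T i (Suc n))) = (\<lambda>u. u < v \<and> {u, v} \<in> edges T)"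
      by blast
    then show ?thesis using attach.IH[of v] False attach.prems by simp
  qed
qed

definition parent :: "nat ugraph \<Rightarrow> nat \<Rightarrow> nat" where
  "parent T v = (THE u. u < v \<and> {u, v} \<in> edges T)"

lemma parent_eqI:
  assumes "rec_tree n T" "u < v" "{u, v} \<in> edges T"
  shows "parent T v = u"
proof -
  have "v \<in> {2..n}" using rec_tree_edge[OF assms(1,3)] assms(2)
    by (auto simp: doubleton_eq_iff)
  then show ?thesis using rec_tree_unique_parent[OF assms(1)] assms(2,3)
    unfolding parent_def by (intro the1_equality) auto
qed

lemma parent_less:
  assumes "rec_tree n T" "v \<in> {2..n}"
  shows "parent T v < v" "{parent T v, v} \<in> edges T"
  using theI'[OF rec_tree_unique_parent[OF assms]] by (auto simp: parent_def)

lemma parent_ge1: "rec_tree n T \<Longrightarrow> v \<in> {2..n} \<Longrightarrow> 1 \<le> parent T v"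
  using parent_less[of n T v] rec_tree_edge[of n T "{parent T v, v}"]
  by (auto simp: doubleton_eq_iff)

lemma parent_attach_old:
  assumes T: "rec_tree n T" and i: "i \<in> {1..n}" and v: "v \<in> {2..n}"
  shows "parent (attach_leaf T i (Suc n)) v = parent T v"
  using parent_less[OF T v] by (intro parent_eqI[OF rec_tree.attach[OF T i]]) auto

lemma parent_attach_new:
  assumes T: "rec_tree n T" and i: "i \<in> {1..n}"
  shows "parent (attach_leaf T i (Suc n)) (Suc n) = i"
  using i by (intro parent_eqI[OF rec_tree.attach[OF T i]]) auto

lemma rec_tree_simple: "rec_tree n T \<Longrightarrow> simple_graph T"
  unfolding simple_graph_def using rec_tree_edge rec_tree_verts
  by (fastforce simp: card_insert_if)

lemma rec_tree_connected: "rec_tree n T \<Longrightarrow> connected_graph T"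
proof (induction rule: rec_tree.induct)
  case two
  have "path \<lparr>verts = {1, 2}, edges = {{1, 2}}\<rparr> u (if u = v then [u] else [u, v]) v"
    if "u \<in> {1, 2}" "v \<in> {1, 2}" for u v :: nat
    using that by (auto simp: path_def insert_commute)
  then show ?case unfolding connected_graph_def by (metis insert_not_empty ugraph.select_convs(1))
next
  case (attach n T i)
  let ?T = "attach_leaf T i (Suc n)"
  have vT: "verts T = {1..n}" using rec_tree_verts attach by auto
  have old: "path ?T u p v" if "path T u p v" for u p v
    using that unfolding path_def
    by (auto elim: successively_mono)
  have ex: "\<exists>p. path T u p v" if "u \<in> verts T" "v \<in> verts T" for u v
    using attach.IH that by (auto simp: connected_graph_def)
  have "\<exists>p. path ?T u p v" if u: "u \<in> verts ?T" and v: "v \<in> verts ?T" for u v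
  proof -
    consider "u \<in> verts T" "v \<in> verts T" | "u = Suc n" "v \<in> verts T"
      | "u \<in> verts T" "v = Suc n" | "u = Suc n" "v = Suc n" using u v by auto
    then show ?thesis
    proof cases
      case 1 then show ?thesis using ex old by blast
    next
      case 2
      then obtain p where p: "path T i p v" using ex[of i v] attach vT by auto
      then have "path ?T u (u # p) v"
        using old[OF p] p 2 vT unfolding path_def
        by (auto simp: successively_Cons insert_commute)
      then show ?thesis ..
    next
      case 3
      then obtain p where p: "path T u p i" using ex[of u i] attach vT by auto
      then have "path ?T u (p @ [v]) v"
        using old[OF p] p 3 vT unfolding path_def
        by (auto simp: successively_append_iff insert_commute)
      then show ?thesis ..
    next
      case 4
      then have "path ?T u [u] v" by (auto simp: path_def)
      then show ?thesis ..
    qed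
  qed
  then show ?case by (simp add: connected_graph_def)
qed

text \<open>The largest vertex of a cycle would have two distinct smaller neighbours.\<close>

lemma rec_tree_acyclic:
  assumes T: "rec_tree n T"
  shows "\<not> cycle T p"
proof
  assume c: "cycle T p"
  define l where "l = length p"
  have l3: "l \<ge> 3" and d: "distinct p" and ne: "p \<noteq> []"
    using c by (auto simp: cycle_def l_def)
  \<comment> \<open>Cyclic indices treat the closing edge like the others.\<close>
  have adj: "{p ! j, p ! ((j + 1) mod l)} \<in> edges T" if "j < l" for j
  proof (cases "Suc j < l")
    case True
    then show ?thesis using c by (auto simp: cycle_def successively_conv_nth l_def)
  next
    case False
    then have "j = l - 1" using that by auto
    then show ?thesis using c ne l3 by (auto simp: cycle_def l_def last_conv_nth hd_conv_nth)
  qed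
  define m where "m = Max (set p)"
  have "m \<in> set p" using ne by (auto simp: m_def)
  then obtain j where j: "j < l" "p ! j = m" by (auto simp: in_set_conv_nth l_def)
  define a where "a = (j + 1) mod l"
  define b where "b = (if j = 0 then l - 1 else j - 1)"
  have ab: "a < l" "b < l" "a \<noteq> j" "b \<noteq> j" "a \<noteq> b" "(b + 1) mod l = j"
    using j l3 by (auto simp: a_def b_def mod_Suc)
  have less: "p ! x < m" if "x < l" "x \<noteq> j" for x
  proof -
    have "p ! x \<le> m" using that by (auto simp: m_def l_def)
    moreover have "p ! x \<noteq> m" using that j d by (auto simp: nth_eq_iff_index_eq l_def)
    ultimately show ?thesis by simp
  qed
  have "{p ! a, m} \<in> edges T" using adj[OF j(1)] j by (simp add: a_def insert_commute)
  moreover have "{p ! b, m} \<in> edges T" using adj[OF ab(2)] ab j by simp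
  ultimately have "p ! a = p ! b" using less ab parent_eqI[OF T] by metis
  then show False using ab d by (simp add: nth_eq_iff_index_eq l_def)
qed

lemma rec_tree_tree: "rec_tree n T \<Longrightarrow> tree T"
  unfolding tree_def using rec_tree_simple rec_tree_connected rec_tree_acyclic by blast

section \<open>Blocks hanging from the first vertices\<close>

text \<open>The test \<open>v \<le> parent T v\<close> only ensures termination on arbitrary graphs; it fails for every vertex
  \<open>v \<ge> 2\<close> of a recursive tree.\<close>

function anchor :: "nat ugraph \<Rightarrow> nat \<Rightarrow> nat \<Rightarrow> nat" where
  "anchor T M v = (if v \<le> M \<or> v \<le> parent T v then v else anchor T M (parent T v))"
  by auto
termination by (relation "Wellfounded.measure (\<lambda>(T, M, v). v)") auto

declare anchor.simps [simp del]

lemma anchor_initial [simp]: "v \<le> M \<Longrightarrow> anchor T M v = v"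
  by (simp add: anchor.simps)

lemma anchor_parent:
  assumes "rec_tree n T" "v \<in> {2..n}" "M < v"
  shows "anchor T M v = anchor T M (parent T v)"
  using parent_less(1)[OF assms(1,2)] assms(3) by (subst anchor.simps) auto

lemma anchor_range:
  assumes T: "rec_tree n T" and M: "1 \<le> M"
  shows "v \<in> {1..n} \<Longrightarrow> anchor T M v \<in> {1..M}"
proof (induction v rule: less_induct)
  case (less v)
  show ?case
  proof (cases "v \<le> M")
    case True then show ?thesis using less.prems by simp
  next
    case False
    then have v: "v \<in> {2..n}" using less.prems M by auto
    then have "parent T v < v" "parent T v \<in> {1..n}"
      using parent_less(1)[OF T v] parent_ge1[OF T v] by auto
    then show ?thesis using less.IH anchor_parent[OF T v] False by simp
  qed
qed

lemma anchor_attach_old: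
  assumes T: "rec_tree n T" and i: "i \<in> {1..n}" and M: "1 \<le> M"
  shows "v \<in> {1..n} \<Longrightarrow> anchor (attach_leaf T i (Suc n)) M v = anchor T M v"
proof (induction v rule: less_induct)
  case (less v)
  show ?case
  proof (cases "v \<le> M")
    case False
    then have v: "v \<in> {2..n}" "v \<in> {2..Suc n}" using less.prems M by auto
    have "parent T v < v" "parent T v \<in> {1..n}"
      using parent_less(1)[OF T v(1)] parent_ge1[OF T v(1)] v by auto
    then show ?thesis
      using less.IH False anchor_parent[OF T v(1)]
        anchor_parent[OF rec_tree.attach[OF T i] v(2)] parent_attach_old[OF T i v(1)]
      by simp
  qed simp
qed

lemma anchor_attach_new:
  assumes T: "rec_tree n T" and i: "i \<in> {1..n}" and M: "1 \<le> M" "M \<le> n"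
  shows "anchor (attach_leaf T i (Suc n)) M (Suc n) = anchor T M i"
  using anchor_parent[OF rec_tree.attach[OF T i], of "Suc n" M] M
    parent_attach_new[OF T i] anchor_attach_old[OF T i M(1) i] rec_tree_ge2[OF T] by simp

definition block :: "nat ugraph \<Rightarrow> nat \<Rightarrow> nat \<Rightarrow> nat set" where
  "block T M k = {v \<in> verts T. anchor T M v = k}"

lemma finite_block: "rec_tree n T \<Longrightarrow> finite (block T M k)"
  using rec_tree_verts by (auto simp: block_def)

lemma block_initial:
  assumes "rec_tree n T" "k \<in> {1..n}"
  shows "block T n k = {k}"
  using rec_tree_verts[OF assms(1)] assms(2) by (auto simp: block_def)

lemma block_attach:
  assumes T: "rec_tree n T" and i: "i \<in> {1..n}" and M: "1 \<le> M" "M \<le> n"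
  shows "block (attach_leaf T i (Suc n)) M k =
    block T M k \<union> (if anchor T M i = k then {Suc n} else {})"
  using anchor_attach_old[OF T i M(1)] anchor_attach_new[OF T i M] rec_tree_verts[OF T]
  by (auto simp: block_def)

lemma degree_attach:
  assumes T: "rec_tree n T" and i: "i \<in> {1..n}" and v: "v \<in> {1..Suc n}"
  shows "degree (attach_leaf T i (Suc n)) v =
    (if v = Suc n then 1 else degree T v + (if v = i then 1 else 0))"
proof -
  have fin: "finite {e \<in> edges T. w \<in> e}" for w using rec_tree_finite_edges[OF T] by simp
  have new: "Suc n \<notin> e" if "e \<in> edges T" for e
    using rec_tree_edge_bound[OF T that] by fastforce
  then have "{i, Suc n} \<notin> edges T" by blast
  moreover have "{e \<in> edges (attach_leaf T i (Suc n)). v \<in> e} =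
      (if v = i \<or> v = Suc n then insert {i, Suc n} {e \<in> edges T. v \<in> e} else {e \<in> edges T. v \<in> e})"
    by auto
  moreover have "{e \<in> edges T. Suc n \<in> e} = {}" using new by blast
  ultimately show ?thesis using fin i by (auto simp: degree_def)
qed

lemma degree_two:
  "degree \<lparr>verts = {1, 2}, edges = {{1, 2 :: nat}}\<rparr> 1 = 1"
  "degree \<lparr>verts = {1, 2}, edges = {{1, 2 :: nat}}\<rparr> 2 = 1"
  by (auto simp: degree_def Collect_conv_if)

lemma degree_ge1: "rec_tree n T \<Longrightarrow> v \<in> {1..n} \<Longrightarrow> 1 \<le> degree T v"
proof (induction arbitrary: v rule: rec_tree.induct)
  case two then have "v = 1 \<or> v = 2" by auto
  then show ?case using degree_two by auto
next
  case (attach n T i) then show ?case using degree_attach[OF attach.hyps(1,2) attach.prems] by auto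
qed

lemma degree_newest: "rec_tree n T \<Longrightarrow> degree T n = 1"
  by (cases rule: rec_tree.cases) (use degree_two in \<open>auto simp: degree_attach\<close>)

lemma sum_degree: "rec_tree n T \<Longrightarrow> (\<Sum>v\<in>verts T. degree T v) = 2 * (n - 1)"
proof (induction rule: rec_tree.induct)
  case two then show ?case using degree_two by simp
next
  case (attach n T i)
  have "verts (attach_leaf T i (Suc n)) = insert (Suc n) {1..n}"
    using rec_tree_verts[OF attach.hyps(1)] by auto
  then have "(\<Sum>v\<in>verts (attach_leaf T i (Suc n)). degree (attach_leaf T i (Suc n)) v)
      = 1 + (\<Sum>v=1..n. degree T v + (if v = i then 1 else 0))"
    using degree_attach[OF attach.hyps(1,2)] by (auto intro!: sum.cong)
  also have "\<dots> = 2 * (Suc n - 1)"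
    using attach rec_tree_verts[OF attach.hyps(1)] rec_tree_ge2[OF attach.hyps(1)]
    by (simp add: sum.distrib)
  finally show ?case .
qed

text \<open>Halving the degrees normalizes the increments to one.\<close>

definition weight :: "nat ugraph \<Rightarrow> nat \<Rightarrow> nat \<Rightarrow> real" where
  "weight T M k = (\<Sum>v\<in>block T M k. real (degree T v)) / 2"

lemma weight_nonneg: "0 \<le> weight T M k"
  by (simp add: weight_def sum_nonneg)

lemma weight_initial:
  "rec_tree n T \<Longrightarrow> k \<in> {1..n} \<Longrightarrow> weight T n k = real (degree T k) / 2"
  by (simp add: weight_def block_initial)

lemma weight_attach:
  assumes T: "rec_tree n T" and i: "i \<in> {1..n}" and M: "1 \<le> M" "M \<le> n"
  shows "weight (attach_leaf T i (Suc n)) M k = weight T M k + (if anchor T M i = k then 1 else 0)"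
proof -
  let ?T = "attach_leaf T i (Suc n)"
  have B: "block T M k \<subseteq> {1..n}" unfolding block_def rec_tree_verts[OF T] by blast
  have fin: "finite (block T M k)" by (rule finite_block[OF T])
  have mem: "i \<in> block T M k \<longleftrightarrow> anchor T M i = k" using i rec_tree_verts[OF T] by (auto simp: block_def)
  have "(\<Sum>v\<in>block T M k. real (degree ?T v)) = (\<Sum>v\<in>block T M k. real (degree T v) + (if v = i then 1 else 0))"
  proof (rule sum.cong[OF refl])
    fix v assume "v \<in> block T M k"
    then have "v \<in> {1..Suc n}" "v \<noteq> Suc n" using B by auto
    then show "real (degree ?T v) = real (degree T v) + (if v = i then 1 else 0)"
      using degree_attach[OF T i, of v] by simp
  qed
  also have "\<dots> = (\<Sum>v\<in>block T M k. real (degree T v)) + (if anchor T M i = k then 1 else 0)"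
    unfolding sum.distrib sum.delta[OF fin] mem ..
  finally have old: "(\<Sum>v\<in>block T M k. real (degree ?T v)) = \<dots>" .
  have "Suc n \<notin> block T M k" using B by auto
  moreover have "degree ?T (Suc n) = 1" using degree_attach[OF T i, of "Suc n"] by simp
  ultimately show ?thesis
    unfolding weight_def block_attach[OF T i M] using old fin by auto
qed

lemma card_block_attach:
  assumes T: "rec_tree n T" and i: "i \<in> {1..n}" and M: "1 \<le> M" "M \<le> n"
  shows "card (block (attach_leaf T i (Suc n)) M k) = card (block T M k) + (if anchor T M i = k then 1 else 0)"
proof -
  have "Suc n \<notin> block T M k" using rec_tree_verts[OF T] by (auto simp: block_def)
  then show ?thesis unfolding block_attach[OF T i M] using finite_block[OF T] by auto
qed

text \<open>A block starts with one vertex of degree at least 1, and each new vertex raises its total degree by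
  two. Thus tail bounds for weights are tail bounds for sizes.\<close>

lemma card_block_le_weight:
  "rec_tree n T \<Longrightarrow> 2 \<le> M \<Longrightarrow> M \<le> n \<Longrightarrow> k \<in> {1..M} \<Longrightarrow> real (card (block T M k)) \<le> weight T M k + 1 / 2"
proof (induction rule: rec_tree.induct)
  case two
  then have "M = 2" by simp
  then show ?case
    using two weight_initial[OF rec_tree.two, of k] block_initial[OF rec_tree.two, of k]
      degree_ge1[OF rec_tree.two, of k] by simp
next
  case (attach n T i)
  note T' = rec_tree.attach[OF attach.hyps]
  show ?case
  proof (cases "M = Suc n")
    case True
    then show ?thesis
      using attach.prems weight_initial[OF T', of k] block_initial[OF T', of k] degree_ge1[OF T', of k]
      by simp
  next
    case False
    then show ?thesis
      using attach weight_attach[OF attach.hyps(1,2)] card_block_attach[OF attach.hyps(1,2)] by auto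
  qed
qed

text \<open>For the two halves the starting degrees are exactly 1, so the size determines the weight, and the
  sizes themselves form a Markov chain.\<close>

lemma card_block_eq_weight:
  "rec_tree n T \<Longrightarrow> k \<in> {1, 2} \<Longrightarrow> real (card (block T 2 k)) = weight T 2 k + 1 / 2"
proof (induction rule: rec_tree.induct)
  case two
  then show ?case
    using weight_initial[OF rec_tree.two, of k] block_initial[OF rec_tree.two, of k] degree_two
    by force
next
  case (attach n T i)
  then show ?case
    using rec_tree_ge2[OF attach.hyps(1)]
      weight_attach[OF attach.hyps(1,2), of 2] card_block_attach[OF attach.hyps(1,2), of 2] by simp
qed

lemma card_blocks_two:
  assumes "rec_tree n T"
  shows "card (block T 2 1) + card (block T 2 2) = n"
proof -
  have "block T 2 1 \<union> block T 2 2 = {1..n}" "block T 2 1 \<inter> block T 2 2 = {}"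
    using anchor_range[OF assms, of 2] rec_tree_verts[OF assms] by (force simp: block_def)+
  then show ?thesis
    using card_Un_disjoint[OF finite_block[OF assms] finite_block[OF assms]] by (metis card_atLeastAtMost diff_Suc_1)
qed

section \<open>Centrality in terms of block sizes\<close>

lemma successively_crossing:
  assumes "successively P p" "p \<noteq> []" "f (hd p) \<noteq> f (last p)"
  obtains x y where "x \<in> set p" "y \<in> set p" "P x y" "f x = f (hd p)" "f y \<noteq> f (hd p)"
  using assms
proof (induction p arbitrary: thesis)
  case (Cons a p)
  show ?case
  proof (cases "p = [] \<or> f (hd p) \<noteq> f a")
    case True
    then have "p \<noteq> []" "f (hd p) \<noteq> f a" using Cons.prems(4) by (auto split: if_splits)
    then show ?thesis using Cons.prems(1)[of a "hd p"] Cons.prems(2) by (auto simp: successively_Cons)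
  next
    case False
    then obtain x y where "x \<in> set p" "y \<in> set p" "P x y" "f x = f a" "f y \<noteq> f a"
      using Cons.IH Cons.prems(2-) by (auto simp: successively_Cons)
    then show ?thesis using Cons.prems(1)[of x y] by simp
  qed
qed simp

text \<open>A vertex larger than \<open>M\<close> lies in the same block as its parent, so blocks are only joined by edges
  within the first \<open>M\<close> vertices.\<close>

lemma edge_crossing_blocks:
  assumes T: "rec_tree n T" and e: "{x, y} \<in> edges T" and ne: "anchor T M x \<noteq> anchor T M y"
  shows "x \<le> M" "y \<le> M"
proof -
  have *: "u \<le> M \<and> v \<le> M" if "u < v" "{u, v} \<in> edges T" "anchor T M u \<noteq> anchor T M v" for u v
  proof (rule ccontr)
    assume "\<not> ?thesis"
    then have "M < v" using that by auto
    moreover have "v \<in> {2..n}" using rec_tree_edge[OF T that(2)] that(1) by (auto simp: doubleton_eq_iff)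
    ultimately show False
      using anchor_parent[OF T] parent_eqI[OF T that(1,2)] that(3) by auto
  qed
  have "x \<le> M \<and> y \<le> M"
  proof (cases x y rule: linorder_cases)
    case less then show ?thesis using * e ne by blast
  next
    case equal then show ?thesis using ne by simp
  next
    case greater then show ?thesis using *[of y x] e ne by (simp add: insert_commute)
  qed
  then show "x \<le> M" "y \<le> M" by simp_all
qed

text \<open>At the first edge that leaves the initial block both end points are at most \<open>M\<close>, and the only
  vertex of a block with this property is the one that the block is named after.\<close>

lemma path_crossing_blocks:
  assumes T: "rec_tree n T" and p: "path T u p v" and ne: "anchor T M u \<noteq> anchor T M v"
  obtains y where "anchor T M u \<in> set p" "y \<in> set p" "{anchor T M u, y} \<in> edges T" 
    "anchor T M u \<le> M" "y \<le> M"
proof -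
  let ?a = "anchor T M"
  have "successively (\<lambda>x y. {x, y} \<in> edges T) p" "p \<noteq> []" "?a (hd p) \<noteq> ?a (last p)" and hd: "hd p = u"
    using p ne by (auto simp: path_def)
  from successively_crossing[OF this(1-3)]
  obtain x y where xy: "x \<in> set p" "y \<in> set p" "{x, y} \<in> edges T"
      "anchor T M x = anchor T M u" "anchor T M y \<noteq> anchor T M u"
    unfolding hd by blast
  have "anchor T M x \<noteq> anchor T M y" using xy(4,5) by metis
  note M = edge_crossing_blocks[OF T xy(3) this]
  have "anchor T M u = x" using anchor_initial[OF M(1)] xy(4) by metis
  then show ?thesis using that[of y] xy(1-3) M by metis
qed

lemma psi_ge:
  assumes "rec_tree n T" "v \<in> verts T" "v \<noteq> u"
  shows "card (descendants T u v) \<le> psi T u"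
  unfolding psi_def using assms rec_tree_verts by (intro Max_ge) auto

text \<open>How lower bounds on \<open>psi\<close> arise: a vertex \<open>v\<close> that is passed by all paths from \<open>u\<close> out of a block
  has everything outside the block as a descendant.\<close>

lemma card_outside_block_le_descendants:
  assumes T: "rec_tree n T" and u: "u \<in> {1..n}"
    and pass: "\<And>p w. path T u p w \<Longrightarrow> anchor T M w \<noteq> k \<Longrightarrow> v \<in> set p"
  shows "n - card (block T M k) \<le> card (descendants T u v)"
proof -
  have V: "verts T = {1..n}" by (rule rec_tree_verts[OF T])
  have "verts T - block T M k \<subseteq> descendants T u v"
  proof
    fix w assume w: "w \<in> verts T - block T M k"
    then obtain p where "path T u p w"
      using rec_tree_connected[OF T] u V unfolding connected_graph_def by blast
    then show "w \<in> descendants T u v" using w pass by (auto simp: descendants_def block_def)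
  qed
  then have "card (verts T - block T M k) \<le> card (descendants T u v)"
    using V by (intro card_mono) (auto simp: descendants_def)
  moreover have "card (verts T - block T M k) = n - card (block T M k)"
    using card_Diff_subset[OF finite_block[OF T], of M k "verts T"] V by (force simp: block_def)
  ultimately show ?thesis by simp
qed

lemma psi_lower_late:
  assumes T: "rec_tree n T" and M: "1 \<le> M" and u: "u \<in> {1..n}" "M < u"
  shows "n - card (block T M (anchor T M u)) \<le> psi T u"
proof -
  let ?k = "anchor T M u"
  have k: "?k \<in> {1..M}" using anchor_range[OF T M u(1)] .
  have "?k \<in> set p" if "path T u p w" "anchor T M w \<noteq> ?k" for p w
    using path_crossing_blocks[OF T that(1)] that(2) by metis
  then have "n - card (block T M ?k) \<le> card (descendants T u ?k)"
    by (rule card_outside_block_le_descendants[OF T u(1)])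
  also have "\<dots> \<le> psi T u" using k u rec_tree_verts[OF T] by (intro psi_ge[OF T]) auto
  finally show ?thesis .
qed

text \<open>For \<open>M = 2\<close> this always holds; for larger \<open>M\<close> it says that the tree on the first \<open>M\<close> vertices is a
  star around the root.\<close>

definition starlike :: "nat ugraph \<Rightarrow> nat \<Rightarrow> bool" where
  "starlike T M \<longleftrightarrow> (\<forall>v\<in>{2..M}. {1, v} \<in> edges T)"

text \<open>In the starlike case two blocks are only joined by edges at the root, which gives two-sided control:
  every path between different blocks visits the root.\<close>

lemma path_leaving_block_starlike:
  assumes T: "rec_tree n T" and star: "starlike T M" and p: "path T u p w"
    and ne: "anchor T M u \<noteq> anchor T M w"
  shows "1 \<in> set p"
proof -
  let ?k = "anchor T M u"
  obtain y where y: "?k \<in> set p" "y \<in> set p" "{?k, y} \<in> edges T" "?k \<le> M" "y \<le> M"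
    using path_crossing_blocks[OF T p ne] by blast
  have *: "a = 1" if "a < b" "{a, b} \<in> edges T" "b \<le> M" for a b
  proof -
    have "1 \<le> a" using rec_tree_edge[OF T that(2)] that(1) by (auto simp: doubleton_eq_iff)
    then have b: "b \<in> {2..M}" "1 < b" using that by auto
    then show ?thesis using star parent_eqI[OF T that(1,2)] parent_eqI[OF T, of 1 b] by (auto simp: starlike_def)
  qed
  have "?k \<noteq> y" using rec_tree_edge[OF T y(3)] by (auto simp: doubleton_eq_iff)
  then show ?thesis using *[of ?k y] *[of y ?k] y by (cases ?k y rule: linorder_cases) (auto simp: insert_commute)
qed

lemma psi_lower_starlike:
  assumes T: "rec_tree n T" and star: "starlike T M" and u: "u \<in> {2..n}"
  shows "n - card (block T M (anchor T M u)) \<le> psi T u"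
proof -
  have "n - card (block T M (anchor T M u)) \<le> card (descendants T u 1)"
    using u by (intro card_outside_block_le_descendants[OF T])
      (auto dest: path_leaving_block_starlike[OF T star])
  also have "\<dots> \<le> psi T u" using u rec_tree_verts[OF T] by (intro psi_ge[OF T]) auto
  finally show ?thesis .
qed

text \<open>A path from the root to a descendant of \<open>v \<noteq> 1\<close> does not come back to the root after passing \<open>v\<close>, hence
  never changes its block from there on. The descendants of \<open>v\<close> therefore stay in one block.\<close>

lemma psi_root_upper_starlike:
  assumes T: "rec_tree n T" and M: "1 \<le> M" and star: "starlike T M"
  shows "\<exists>k\<in>{1..M}. psi T 1 \<le> card (block T M k)"
proof -
  have n2: "2 \<le> n" and V: "verts T = {1..n}" using rec_tree_ge2[OF T] rec_tree_verts[OF T] by auto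
  have "psi T 1 \<in> (\<lambda>v. card (descendants T 1 v)) ` (verts T - {1})"
    unfolding psi_def
  proof (rule Max_in)
    have "2 \<in> verts T - {1}" using V n2 by simp
    then show "(\<lambda>v. card (descendants T 1 v)) ` (verts T - {1}) \<noteq> {}" by blast
  qed (use V in simp)
  then obtain v where v: "v \<in> {1..n}" "v \<noteq> 1" "psi T 1 = card (descendants T 1 v)"
    unfolding V by blast
  have "descendants T 1 v \<subseteq> block T M (anchor T M v)"
  proof
    fix w assume "w \<in> descendants T 1 v"
    then obtain p where w: "w \<in> verts T" and p: "path T 1 p w" "v \<in> set p" by (auto simp: descendants_def)
    obtain p1 p2 where s: "p = p1 @ v # p2" using p(2) by (meson split_list)
    have "p1 \<noteq> []" using p(1) s v(2) by (auto simp: path_def)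
    then have "1 \<in> set p1" using p(1) s hd_in_set[of p1] by (simp add: path_def)
    then have "1 \<notin> set (v # p2)" using p(1) s by (auto simp: path_def)
    moreover have "path T v (v # p2) w" using p(1) s by (auto simp: path_def successively_append_iff)
    ultimately have "anchor T M v = anchor T M w" using path_leaving_block_starlike[OF T star] by blast
    then show "w \<in> block T M (anchor T M v)" using w by (simp add: block_def)
  qed
  then have "psi T 1 \<le> card (block T M (anchor T M v))"
    unfolding v(3) by (intro card_mono finite_block[OF T])
  then show ?thesis using anchor_range[OF T M v(1)] by blast
qed

lemma starlike_two: "rec_tree n T \<Longrightarrow> starlike T 2"
  by (induction rule: rec_tree.induct) (auto simp: starlike_def)

section \<open>The growth process\<close>

lemma expectation_bind_pmf_finite:
  fixes h :: "'b \<Rightarrow> real"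
  assumes "finite (set_pmf p)" "\<And>x. x \<in> set_pmf p \<Longrightarrow> finite (set_pmf (f x))"
  shows "measure_pmf.expectation (p \<bind> f) h =
    measure_pmf.expectation p (\<lambda>x. measure_pmf.expectation (f x) h)"
  using assms
  by (subst pmf_expectation_bind[of "set_pmf p"]) (auto simp: integral_measure_pmf[of "set_pmf p"])

lemma expectation_cong_pmf:
  fixes f g :: "'a \<Rightarrow> real"
  assumes "\<And>x. x \<in> set_pmf p \<Longrightarrow> f x = g x"
  shows "measure_pmf.expectation p f = measure_pmf.expectation p g"
  using assms by (intro integral_cong_AE) (auto simp: AE_measure_pmf_iff)

lemma pmf_degree_biased_rec_tree:
  assumes T: "rec_tree n T"
  shows "pmf (degree_biased T) i = (if i \<in> {1..n} then real (degree T i) / (2 * (real n - 1)) else 0)"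
proof -
  have n: "2 \<le> n" and V: "verts T = {1..n}" using rec_tree_ge2[OF T] rec_tree_verts[OF T] .
  have s: "(\<Sum>j\<in>verts T. degree T j) = 2 * (n - 1)" by (rule sum_degree[OF T])
  then have "(\<Sum>j\<in>verts T. real (degree T j)) = 2 * (real n - 1)"
    using n by (simp flip: of_nat_sum add: of_nat_diff)
  then show ?thesis using pmf_degree_biased[of T i] n s unfolding V by simp
qed

lemma set_pmf_degree_biased:
  assumes T: "rec_tree n T"
  shows "set_pmf (degree_biased T) = {1..n}"
proof -
  have "degree T i \<noteq> 0" if "i \<in> {1..n}" for i using degree_ge1[OF T that] by simp
  then show ?thesis
    using rec_tree_ge2[OF T]
    by (auto simp: set_pmf_iff pmf_degree_biased_rec_tree[OF T] split: if_splits)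
qed

text \<open>The attachment step in the form of an urn: all degrees add up to twice the number \<open>n - 1\<close> of edges, so a
  set whose halved degrees add up to \<open>w\<close> is hit with probability \<open>w / (n - 1)\<close>.\<close>

lemma expectation_degree_biased:
  fixes a b :: real
  assumes T: "rec_tree n T" and A: "A \<subseteq> {1..n}" and w: "(\<Sum>i\<in>A. real (degree T i)) / 2 = w"
  shows "measure_pmf.expectation (degree_biased T) (\<lambda>i. if i \<in> A then a else b) =
    w / (real n - 1) * a + (1 - w / (real n - 1)) * b"
proof -
  let ?p = "degree_biased T"
  have fin: "finite A" using A finite_subset by blast
  have "measure_pmf.expectation ?p (\<lambda>i. if i \<in> A then a else b)
      = measure_pmf.expectation ?p (\<lambda>i. b + (a - b) * indicator A i)"
    by (intro arg_cong[of _ _ "measure_pmf.expectation ?p"]) (auto simp: indicator_def)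
  also have "\<dots> = b + (a - b) * measure_pmf.prob ?p A"
    using set_pmf_degree_biased[OF T] by (subst Bochner_Integration.integral_add)
      (auto intro!: integrable_measure_pmf_finite)
  also have "measure_pmf.prob ?p A = (\<Sum>i\<in>A. real (degree T i) / (2 * (real n - 1)))"
    unfolding measure_measure_pmf_finite[OF fin] using A
    by (intro sum.cong) (auto simp: pmf_degree_biased_rec_tree[OF T])
  also have "\<dots> = w / (real n - 1)"
    unfolding w[symmetric] by (simp add: sum_divide_distrib[symmetric])
  finally show ?thesis by (simp add: algebra_simps diff_divide_distrib)
qed

text \<open>Conditioning the preferential attachment tree on its shape at an earlier time \<open>m\<close> is expressed by starting
  afresh from a tree \<open>T\<close> of that size; new labels continue after \<open>m\<close>.\<close>

primrec grow :: "nat \<Rightarrow> nat \<Rightarrow> nat ugraph \<Rightarrow> nat ugraph pmf" where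
  "grow m 0 T = return_pmf T"
| "grow m (Suc j) T = do {
     T' \<leftarrow> grow m j T;
     i \<leftarrow> degree_biased T';
     return_pmf (attach_leaf T' i (Suc (m + j)))
   }"

text \<open>The Markov property, which allows statements about the growth from a given tree to be averaged over
  that tree.\<close>

lemma PA_add: "2 \<le> m \<Longrightarrow> PA (m + j) = PA m \<bind> grow m j"
proof (induction j)
  case 0 then show ?case by (simp add: bind_return_pmf')
next
  case (Suc j) then show ?case by (simp add: bind_assoc_pmf)
qed

lemma PA_two: "PA 2 = return_pmf \<lparr>verts = {1, 2}, edges = {{1, 2}}\<rparr>"
  by (simp add: numeral_2_eq_2)

lemma PA_eq_grow: "2 \<le> n \<Longrightarrow> PA n = grow 2 (n - 2) \<lparr>verts = {1, 2}, edges = {{1, 2}}\<rparr>"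
  using PA_add[of 2 "n - 2"] unfolding PA_two bind_return_pmf by (metis le_add_diff_inverse le_refl)

lemma rec_tree_grow:
  assumes T: "rec_tree m T"
  shows "T' \<in> set_pmf (grow m j T) \<Longrightarrow> rec_tree (m + j) T'"
proof (induction j arbitrary: T')
  case (Suc j)
  then obtain S i where S: "rec_tree (m + j) S" "i \<in> set_pmf (degree_biased S)"
      "T' = attach_leaf S i (Suc (m + j))"
    by (auto simp: set_bind_pmf)
  then show ?case using rec_tree.attach[OF S(1)] unfolding set_pmf_degree_biased[OF S(1)] by simp
qed (use T in simp)

lemma finite_set_pmf_grow:
  assumes T: "rec_tree m T"
  shows "finite (set_pmf (grow m j T))"
  by (induction j) (auto simp: set_bind_pmf set_pmf_degree_biased[OF rec_tree_grow[OF T]])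

lemma set_pmf_PA:
  assumes "2 \<le> n"
  shows "T \<in> set_pmf (PA n) \<longleftrightarrow> rec_tree n T"
proof
  assume "T \<in> set_pmf (PA n)"
  then show "rec_tree n T"
    using rec_tree_grow[OF rec_tree.two, of T "n - 2"] assms
    unfolding PA_eq_grow[OF assms] le_add_diff_inverse[OF assms] by blast
next
  assume "rec_tree n T"
  then show "T \<in> set_pmf (PA n)"
  proof (induction rule: rec_tree.induct)
    case two then show ?case by (simp add: PA_two)
  next
    case (attach n T i)
    then have "i \<in> set_pmf (degree_biased T)"
      unfolding set_pmf_degree_biased[OF attach.hyps(1)] by simp
    then show ?case using attach.IH rec_tree_ge2[OF attach.hyps(1)] by (auto simp: set_bind_pmf)
  qed
qed

lemma finite_set_pmf_PA:
  assumes "2 \<le> n"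
  shows "finite (set_pmf (PA n))"
  unfolding PA_eq_grow[OF assms] by (rule finite_set_pmf_grow[OF rec_tree.two])

lemma expectation_PA_add:
  fixes h :: "nat ugraph \<Rightarrow> real"
  assumes "2 \<le> m"
  shows "measure_pmf.expectation (PA (m + j)) h =
    measure_pmf.expectation (PA m) (\<lambda>T. measure_pmf.expectation (grow m j T) h)"
  unfolding PA_add[OF assms] using assms
  by (intro expectation_bind_pmf_finite finite_set_pmf_PA finite_set_pmf_grow) (auto simp: set_pmf_PA)

text \<open>The way in which one-step identities on the degree-biased choice become recursions for expectations.\<close>

lemma expectation_grow_Suc:
  fixes h :: "nat ugraph \<Rightarrow> real"
  assumes T: "rec_tree m T"
    and step: "\<And>T'. rec_tree (m + j) T' \<Longrightarrow>
      measure_pmf.expectation (degree_biased T') (\<lambda>i. h (attach_leaf T' i (Suc (m + j)))) = g T'"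
  shows "measure_pmf.expectation (grow m (Suc j) T) h = measure_pmf.expectation (grow m j T) g"
proof -
  have fin: "finite (set_pmf (degree_biased T'))" if "T' \<in> set_pmf (grow m j T)" for T'
    using set_pmf_degree_biased[OF rec_tree_grow[OF T that]] by simp
  have "measure_pmf.expectation (grow m (Suc j) T) h =
    measure_pmf.expectation (grow m j T) (\<lambda>T'. measure_pmf.expectation
      (degree_biased T' \<bind> (\<lambda>i. return_pmf (attach_leaf T' i (Suc (m + j))))) h)"
    unfolding grow.simps using fin
    by (intro expectation_bind_pmf_finite finite_set_pmf_grow[OF T]) (auto simp: set_bind_pmf)
  also have "\<dots> = measure_pmf.expectation (grow m j T) g"
  proof (rule expectation_cong_pmf)
    fix T' assume T': "T' \<in> set_pmf (grow m j T)"
    show "measure_pmf.expectation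
      (degree_biased T' \<bind> (\<lambda>i. return_pmf (attach_leaf T' i (Suc (m + j))))) h = g T'"
      using step[OF rec_tree_grow[OF T T']] fin[OF T']
      by (subst expectation_bind_pmf_finite) auto
  qed
  finally show ?thesis .
qed

section \<open>Rising factorial moments\<close>

lemma pochhammer_shift:
  fixes x :: real
  shows "x * pochhammer (x + 1) p = (x + real p) * pochhammer x p"
  by (metis pochhammer_rec pochhammer_rec')

text \<open>Rising factorials are eigenfunctions of the urn transition: with probability \<open>x / (c * N)\<close> the value \<open>x\<close>
  moves to \<open>x + 1\<close>, and the mean of its rising factorial is multiplied by \<open>1 + p / (c * N)\<close>. When
  \<open>p = c * q\<close> this factor is \<open>(N + q) / N\<close>, a quotient of consecutive rising factorials, so that products
  over time telescope. Weights use \<open>c = 1\<close>, degrees \<open>c = 2\<close>.\<close>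

lemma pochhammer_urn_step:
  fixes x c N :: real
  assumes N: "0 < N" and c: "0 < c" and p: "real p = c * real q"
  shows "x / (c * N) * pochhammer (x + 1) p + (1 - x / (c * N)) * pochhammer x p =
    pochhammer x p * (pochhammer (N + 1) q / pochhammer N q)"
proof -
  have "pochhammer (N + 1) q / pochhammer N q = (N + real q) / N"
    using pochhammer_shift[of N q] N pochhammer_pos[OF N, of q] by (simp add: field_simps)
  moreover have "x / (c * N) * pochhammer (x + 1) p = (x + real p) * pochhammer x p / (c * N)"
    by (simp flip: pochhammer_shift[of x p])
  moreover have "(x + real p) * y / (c * N) + (1 - x / (c * N)) * y = y * ((N + real q) / N)" for y
    using N c p by (simp add: field_simps)
  ultimately show ?thesis by presburger
qed

lemma expectation_weight_grow:
  assumes T: "rec_tree m T" and M: "1 \<le> M" "M \<le> m"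
  shows "measure_pmf.expectation (grow m j T) (\<lambda>T'. pochhammer (weight T' M k) p) =
    pochhammer (weight T M k) p * (pochhammer (real (m + j) - 1) p / pochhammer (real m - 1) p)"
proof (induction j)
  case 0
  have "0 < real m - 1" using rec_tree_ge2[OF T] by simp
  then have "pochhammer (real m - 1) p > 0" by (rule pochhammer_pos)
  then show ?case by simp
next
  case (Suc j)
  define N where "N = real (m + j) - 1"
  have N: "0 < N" using rec_tree_ge2[OF T] by (simp add: N_def)
  let ?r = "pochhammer (N + 1) p / pochhammer N p"
  have "measure_pmf.expectation (grow m (Suc j) T) (\<lambda>T'. pochhammer (weight T' M k) p) =
    measure_pmf.expectation (grow m j T) (\<lambda>T'. pochhammer (weight T' M k) p * ?r)"
  proof (rule expectation_grow_Suc[OF T])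
    fix T' assume T': "rec_tree (m + j) T'"
    let ?w = "weight T' M k"
    have mem: "i \<in> block T' M k \<longleftrightarrow> anchor T' M i = k" if "i \<in> {1..m + j}" for i
      using that rec_tree_verts[OF T'] by (simp add: block_def)
    have "measure_pmf.expectation (degree_biased T')
        (\<lambda>i. pochhammer (weight (attach_leaf T' i (Suc (m + j))) M k) p) =
      measure_pmf.expectation (degree_biased T')
        (\<lambda>i. if i \<in> block T' M k then pochhammer (?w + 1) p else pochhammer ?w p)"
      using M mem set_pmf_degree_biased[OF T']
      by (intro expectation_cong_pmf) (simp add: weight_attach[OF T'])
    also have "\<dots> = ?w / N * pochhammer (?w + 1) p + (1 - ?w / N) * pochhammer ?w p"
      unfolding N_def
    proof (rule expectation_degree_biased[OF T'])
      show "block T' M k \<subseteq> {1..m + j}" unfolding block_def rec_tree_verts[OF T'] by blast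
    qed (simp add: weight_def)
    also have "\<dots> = pochhammer ?w p * ?r"
      using pochhammer_urn_step[OF N, of 1 p p ?w] by simp
    finally show "measure_pmf.expectation (degree_biased T')
        (\<lambda>i. pochhammer (weight (attach_leaf T' i (Suc (m + j))) M k) p) = pochhammer ?w p * ?r" .
  qed
  also have "\<dots> = pochhammer (weight T M k) p * (pochhammer N p / pochhammer (real m - 1) p) * ?r"
    using Suc.IH by (simp add: N_def)
  also have "\<dots> = pochhammer (weight T M k) p * (pochhammer (N + 1) p / pochhammer (real m - 1) p)"
    using pochhammer_pos[OF N, of p] by simp
  finally show ?case by (simp add: N_def algebra_simps)
qed

lemma expectation_degree_grow:
  assumes T: "rec_tree m T" and k: "k \<in> {1..m}"
  shows "measure_pmf.expectation (grow m j T) (\<lambda>T'. pochhammer (real (degree T' k)) (2 * q)) =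
    pochhammer (real (degree T k)) (2 * q) * (pochhammer (real (m + j) - 1) q / pochhammer (real m - 1) q)"
proof (induction j)
  case 0
  have "0 < real m - 1" using rec_tree_ge2[OF T] by simp
  then have "pochhammer (real m - 1) q > 0" by (rule pochhammer_pos)
  then show ?case by simp
next
  case (Suc j)
  define N where "N = real (m + j) - 1"
  have N: "0 < N" using rec_tree_ge2[OF T] by (simp add: N_def)
  let ?r = "pochhammer (N + 1) q / pochhammer N q"
  have "measure_pmf.expectation (grow m (Suc j) T) (\<lambda>T'. pochhammer (real (degree T' k)) (2 * q)) =
    measure_pmf.expectation (grow m j T) (\<lambda>T'. pochhammer (real (degree T' k)) (2 * q) * ?r)"
  proof (rule expectation_grow_Suc[OF T])
    fix T' assume T': "rec_tree (m + j) T'"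
    let ?d = "real (degree T' k)"
    have "measure_pmf.expectation (degree_biased T')
        (\<lambda>i. pochhammer (real (degree (attach_leaf T' i (Suc (m + j))) k)) (2 * q)) =
      measure_pmf.expectation (degree_biased T')
        (\<lambda>i. if i \<in> {k} then pochhammer (?d + 1) (2 * q) else pochhammer ?d (2 * q))"
    proof (rule expectation_cong_pmf)
      fix i assume "i \<in> set_pmf (degree_biased T')"
      then have "i \<in> {1..m + j}" unfolding set_pmf_degree_biased[OF T'] .
      from degree_attach[OF T' this, of k] k
      show "pochhammer (real (degree (attach_leaf T' i (Suc (m + j))) k)) (2 * q) =
        (if i \<in> {k} then pochhammer (?d + 1) (2 * q) else pochhammer ?d (2 * q))"
        by (auto simp: add.commute)
    qed
    also have "\<dots> = ?d / 2 / N * pochhammer (?d + 1) (2 * q) + (1 - ?d / 2 / N) * pochhammer ?d (2 * q)"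
      unfolding N_def using k by (intro expectation_degree_biased[OF T']) auto
    also have "\<dots> = pochhammer ?d (2 * q) * ?r"
      using pochhammer_urn_step[OF N, of 2 "2 * q" q ?d] by simp
    finally show "measure_pmf.expectation (degree_biased T')
        (\<lambda>i. pochhammer (real (degree (attach_leaf T' i (Suc (m + j))) k)) (2 * q)) = \<dots>" .
  qed
  also have "\<dots> = pochhammer (real (degree T k)) (2 * q) * (pochhammer N q / pochhammer (real m - 1) q) * ?r"
    using Suc.IH by (simp add: N_def)
  also have "\<dots> = pochhammer (real (degree T k)) (2 * q) * (pochhammer (N + 1) q / pochhammer (real m - 1) q)"
    using pochhammer_pos[OF N, of q] by simp
  finally show ?case by (simp add: N_def algebra_simps)
qed

lemma pochhammer_ge_power:
  fixes x :: real
  assumes "0 \<le> x"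
  shows "x ^ p \<le> pochhammer x p"
proof (induction p)
  case (Suc p)
  have "x ^ p * x \<le> pochhammer x p * (x + real p)"
    using Suc assms by (intro mult_mono) (auto intro: order_trans[OF zero_le_power])
  then show ?case by (simp add: pochhammer_Suc mult.commute)
qed simp

lemma pochhammer_nonneg_real:
  fixes x :: real
  assumes "0 \<le> x"
  shows "0 \<le> pochhammer x p"
  using pochhammer_ge_power[OF assms, of p] assms by (meson order_trans zero_le_power)

lemma pochhammer_mono:
  fixes x y :: real
  assumes "0 \<le> x" "x \<le> y"
  shows "pochhammer x p \<le> pochhammer y p"
  using assms by (induction p) (auto simp: pochhammer_Suc pochhammer_nonneg_real intro!: mult_mono)

lemma pochhammer_le_power:
  fixes x :: real
  assumes "0 \<le> x"
  shows "pochhammer x p \<le> (x + real p) ^ p"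
proof -
  have "pochhammer x p = (\<Prod>i = 0..<p. x + real i)" by (simp add: pochhammer_prod)
  also have "\<dots> \<le> (\<Prod>i = 0..<p. x + real p)" using assms by (intro prod_mono) auto
  finally show ?thesis by simp
qed

lemma prob_eq_expectation: "measure_pmf.prob p A = measure_pmf.expectation p (indicator A :: _ \<Rightarrow> real)"
  by simp

lemma expectation_mono_pmf:
  fixes f g :: "'a \<Rightarrow> real"
  assumes "finite (set_pmf p)" "\<And>x. x \<in> set_pmf p \<Longrightarrow> f x \<le> g x"
  shows "measure_pmf.expectation p f \<le> measure_pmf.expectation p g"
  using assms by (intro integral_mono_AE) (auto simp: AE_measure_pmf_iff integrable_measure_pmf_finite)

lemma expectation_sum_pmf:
  fixes f :: "'b \<Rightarrow> 'a \<Rightarrow> real"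
  assumes "finite (set_pmf p)"
  shows "measure_pmf.expectation p (\<lambda>x. \<Sum>k\<in>I. f k x) = (\<Sum>k\<in>I. measure_pmf.expectation p (f k))"
  using assms by (intro Bochner_Integration.integral_sum) (auto intro: integrable_measure_pmf_finite)

text \<open>Markov's inequality for the rising factorial of order \<open>p\<close>, and a union bound over the blocks.\<close>

lemma prob_heavy_block_grow:
  assumes T: "rec_tree m T" and M: "1 \<le> M" "M \<le> m" and y: "0 < y"
  shows "measure_pmf.prob (grow m j T) {T'. \<exists>k\<in>{1..M}. y \<le> weight T' M k} \<le>
    (\<Sum>k=1..M. pochhammer (weight T M k) p) *
      (pochhammer (real (m + j) - 1) p / (pochhammer (real m - 1) p * pochhammer y p))"
proof -
  let ?A = "{T'. \<exists>k\<in>{1..M}. y \<le> weight T' M k}"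
  let ?E = "measure_pmf.expectation (grow m j T)"
  note fin = finite_set_pmf_grow[OF T, of j]
  have py: "0 < pochhammer y p" using y by (rule pochhammer_pos)
  have nonneg: "0 \<le> pochhammer (weight T' M k) p" for T' k
    by (intro pochhammer_nonneg_real weight_nonneg)
  have "indicator ?A T' \<le> (\<Sum>k=1..M. pochhammer (weight T' M k) p / pochhammer y p)" for T'
  proof (cases "T' \<in> ?A")
    case True
    then obtain k where k: "k \<in> {1..M}" "y \<le> weight T' M k" by auto
    then have "1 \<le> pochhammer (weight T' M k) p / pochhammer y p"
      using pochhammer_mono[of y "weight T' M k" p] y py by simp
    also have "\<dots> \<le> (\<Sum>k=1..M. pochhammer (weight T' M k) p / pochhammer y p)"
      using k(1) nonneg py by (intro member_le_sum) auto
    finally show ?thesis using True by simp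
  qed (use nonneg py in \<open>auto intro!: sum_nonneg\<close>)
  then have "measure_pmf.prob (grow m j T) ?A \<le> ?E (\<lambda>T'. \<Sum>k=1..M. pochhammer (weight T' M k) p / pochhammer y p)"
    unfolding prob_eq_expectation by (intro expectation_mono_pmf fin) auto
  also have "\<dots> = (\<Sum>k=1..M. ?E (\<lambda>T'. pochhammer (weight T' M k) p) / pochhammer y p)"
    by (subst expectation_sum_pmf[OF fin]) simp
  also have "\<dots> = (\<Sum>k=1..M. pochhammer (weight T M k) p *
      (pochhammer (real (m + j) - 1) p / pochhammer (real m - 1) p) / pochhammer y p)"
    by (simp only: expectation_weight_grow[OF T M])
  also have "\<dots> = (\<Sum>k=1..M. pochhammer (weight T M k) p) *
      (pochhammer (real (m + j) - 1) p / (pochhammer (real m - 1) p * pochhammer y p))"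
    unfolding sum_distrib_right by (intro sum.cong) auto
  finally show ?thesis .
qed

lemma rec_tree_two_unique: "rec_tree 2 T \<Longrightarrow> T = \<lparr>verts = {1, 2}, edges = {{1, 2}}\<rparr>"
  by (cases rule: rec_tree.cases) (auto dest: rec_tree_ge2)

lemma degree_at_birth:
  assumes "rec_tree (max k 2) T" "1 \<le> k"
  shows "degree T k = 1"
proof (cases "k = 1")
  case True
  then have "rec_tree 2 T" using assms(1) by (simp add: max_def)
  then show ?thesis using True rec_tree_two_unique[of T] degree_two by simp
next
  case False
  then have "max k 2 = k" using assms(2) by simp
  then show ?thesis using assms(1) degree_newest[of k T] by simp
qed

text \<open>A vertex \<open>k \<ge> 2\<close> has degree 1 at time \<open>k\<close>, and so does the root at time 2; from there the moments grow
  by an explicit factor.\<close>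

lemma expectation_degree_PA:
  assumes k: "1 \<le> k" "k \<le> M" and M: "2 \<le> M"
  shows "measure_pmf.expectation (PA M) (\<lambda>T. pochhammer (real (degree T k)) (2 * q)) =
    fact (2 * q) * (pochhammer (real M - 1) q / pochhammer (real (max k 2) - 1) q)"
proof -
  let ?m = "max k 2"
  let ?r = "fact (2 * q) * (pochhammer (real M - 1) q / pochhammer (real ?m - 1) q)"
  have eq: "?m + (M - ?m) = M" using k M by simp
  have "measure_pmf.expectation (PA M) (\<lambda>T. pochhammer (real (degree T k)) (2 * q)) =
    measure_pmf.expectation (PA ?m) (\<lambda>T. measure_pmf.expectation (grow ?m (M - ?m) T)
      (\<lambda>T. pochhammer (real (degree T k)) (2 * q)))"
    using expectation_PA_add[of ?m "M - ?m"] unfolding eq by simp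
  also have "\<dots> = measure_pmf.expectation (PA ?m) (\<lambda>T. ?r)"
  proof (rule expectation_cong_pmf)
    fix T assume "T \<in> set_pmf (PA ?m)"
    then have T: "rec_tree ?m T" by (subst (asm) set_pmf_PA) auto
    show "measure_pmf.expectation (grow ?m (M - ?m) T) (\<lambda>T. pochhammer (real (degree T k)) (2 * q)) = ?r"
      using k expectation_degree_grow[OF T, of k "M - ?m" q]
      unfolding eq degree_at_birth[OF T k(1)] by (simp add: pochhammer_fact)
  qed
  finally show ?thesis by simp
qed

text \<open>From order two on, \<open>pochhammer (k - 1) q \<ge> (k - 1) * k\<close>, so the terms with \<open>k \<ge> 2\<close> are dominated by a
  telescoping series. This is why the oldest vertices dominate and no factor \<open>M\<close> is lost in the union
  bound.\<close>

lemma sum_inverse_pochhammer_le: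
  assumes q: "2 \<le> q" and M: "1 \<le> M"
  shows "(\<Sum>k=1..M. 1 / pochhammer (real (max k 2) - 1) q) \<le> 2 - 1 / real M"
  using M
proof (induction M rule: dec_induct)
  case base
  show ?case by (simp flip: pochhammer_fact)
next
  case (step M)
  have "pochhammer (real M) 2 \<le> pochhammer (real M) q"
  proof -
    have "pochhammer (real M) q = pochhammer (real M) 2 * pochhammer (real M + 2) (q - 2)"
      using pochhammer_product[OF q, of "real M"] by simp
    moreover have "1 \<le> pochhammer (real M + 2) (q - 2)"
      using pochhammer_ge_power[of "real M + 2" "q - 2"] by (meson le_add_same_cancel2 of_nat_0_le_iff one_le_power order_trans add_nonneg_nonneg zero_le_numeral one_le_numeral)
    moreover have "0 \<le> pochhammer (real M) 2" using step by (intro pochhammer_nonneg) simp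
    ultimately show ?thesis by (metis mult.right_neutral mult_left_mono)
  qed
  moreover have "pochhammer (real M) 2 = real M * (real M + 1)" by (simp add: numeral_2_eq_2 pochhammer_Suc)
  ultimately have "1 / pochhammer (real M) q \<le> 1 / (real M * (real M + 1))"
    using step by (intro divide_left_mono) (auto intro!: mult_pos_pos pochhammer_pos)
  also have "\<dots> = 1 / real M - 1 / real (Suc M)"
    using step by (simp add: field_simps)
  finally show ?case using step by simp
qed

text \<open>The even order \<open>2 * q\<close> makes the degree moments telescope; the factor \<open>pochhammer (M - 1) q\<close> that they
  contribute cancels against one half of \<open>pochhammer (M - 1) (2 * q)\<close>, and about \<open>(M - 1) ^ q\<close> remains in
  the denominator. The blocks thus have relative size about \<open>1 / sqrt M\<close>.\<close>

lemma prob_heavy_block_PA: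
  assumes M: "2 \<le> M" "M \<le> n" and q: "2 \<le> q" "2 * q \<le> n - 1" and \<eta>: "0 < \<eta>"
  shows "measure_pmf.prob (PA n) {T. \<exists>k\<in>{1..M}. \<eta> * (real n - 1) / 2 \<le> weight T M k} \<le>
    2 * ((8 * real q / \<eta>)\<^sup>2 / (real M - 1)) ^ q"
proof -
  define N where "N = real n - 1"
  define y where "y = \<eta> * N / 2"
  define m where "m = real M - 1"
  let ?A = "{T. \<exists>k\<in>{1..M}. y \<le> weight T M k}"
  have N: "0 < N" "real (2 * q) \<le> N" using q M by (auto simp: N_def)
  have y: "0 < y" using N \<eta> by (simp add: y_def)
  have m: "0 < m" using M by (simp add: m_def)
  define R where "R = pochhammer N (2 * q) / (pochhammer m (2 * q) * pochhammer y (2 * q))"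
  have R0: "0 \<le> R" unfolding R_def
    using pochhammer_pos[OF N(1), of "2*q"] pochhammer_pos[OF m, of "2*q"] pochhammer_pos[OF y, of "2*q"] by simp
  have eq: "M + (n - M) = n" using M by simp
  note fin = finite_set_pmf_PA[OF M(1)]
  have "measure_pmf.prob (PA n) ?A = measure_pmf.expectation (PA M) (\<lambda>T. measure_pmf.prob (grow M (n - M) T) ?A)"
    unfolding prob_eq_expectation using expectation_PA_add[OF M(1), of "n - M"] unfolding eq by blast
  also have "\<dots> \<le> measure_pmf.expectation (PA M)
      (\<lambda>T. \<Sum>k=1..M. pochhammer (real (degree T k)) (2 * q) * R)"
  proof (rule expectation_mono_pmf[OF fin])
    fix T assume "T \<in> set_pmf (PA M)"
    then have T: "rec_tree M T" by (simp add: set_pmf_PA M)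
    have "measure_pmf.prob (grow M (n - M) T) ?A \<le> (\<Sum>k=1..M. pochhammer (weight T M k) (2 * q)) * R"
      using prob_heavy_block_grow[OF T, of M y "n - M" "2 * q"] M y unfolding eq R_def N_def m_def by simp
    also have "\<dots> \<le> (\<Sum>k=1..M. pochhammer (real (degree T k)) (2 * q)) * R"
      using R0 by (intro mult_right_mono sum_mono pochhammer_mono weight_nonneg) (simp_all add: weight_initial[OF T])
    finally show "measure_pmf.prob (grow M (n - M) T) ?A \<le> (\<Sum>k=1..M. pochhammer (real (degree T k)) (2 * q) * R)"
      by (simp add: sum_distrib_right)
  qed
  also have "\<dots> = (\<Sum>k=1..M. fact (2 * q) * (pochhammer m q / pochhammer (real (max k 2) - 1) q) * R)"
    unfolding expectation_sum_pmf[OF fin]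
    by (intro sum.cong refl) (simp add: expectation_degree_PA[OF _ _ M(1)] m_def)
  also have "\<dots> = fact (2 * q) * pochhammer m q * R * (\<Sum>k=1..M. 1 / pochhammer (real (max k 2) - 1) q)"
    by (simp add: sum_distrib_left mult_ac)
  also have "\<dots> \<le> fact (2 * q) * pochhammer m q * R * 2"
    using sum_inverse_pochhammer_le[OF q(1), of M] M R0 pochhammer_pos[OF m, of q]
    by (intro mult_left_mono) (auto intro: order_trans[of _ "2 - 1 / real M"])
  also have "\<dots> \<le> 2 * ((2 * real q) ^ (2 * q) * ((4 / \<eta>) ^ (2 * q) / m ^ q))"
  proof -
    have f: "(fact (2 * q) :: real) \<le> (2 * real q) ^ (2 * q)"
      using fact_le_power[of "2 * q", where 'a = real] by simp
    have "pochhammer N (2 * q) \<le> (2 * N) ^ (2 * q)"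
      using pochhammer_le_power[of N "2 * q"] power_mono[of "N + real (2 * q)" "2 * N" "2 * q"] N by linarith
    moreover have "y ^ (2 * q) \<le> pochhammer y (2 * q)" using y by (intro pochhammer_ge_power) simp
    ultimately have "pochhammer N (2 * q) / pochhammer y (2 * q) \<le> (2 * N) ^ (2 * q) / y ^ (2 * q)"
      using N y by (intro frac_le) auto
    also have "\<dots> = (4 / \<eta>) ^ (2 * q)"
      unfolding power_divide[symmetric] using N \<eta> by (simp add: y_def field_simps)
    finally have A: "pochhammer N (2 * q) / pochhammer y (2 * q) \<le> (4 / \<eta>) ^ (2 * q)" .
    have "m ^ q \<le> pochhammer (m + real q) q"
      using pochhammer_ge_power[of m q] pochhammer_mono[of m "m + real q" q] m by simp
    then have B: "1 / pochhammer (m + real q) q \<le> 1 / m ^ q"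
      using m by (intro divide_left_mono) (auto intro!: mult_pos_pos pochhammer_pos)
    have "pochhammer m q * R = (pochhammer N (2 * q) / pochhammer y (2 * q)) * (1 / pochhammer (m + real q) q)"
      unfolding R_def using pochhammer_product'[of m q q] pochhammer_pos[OF m, of q] by (simp add: mult_2)
    also have "\<dots> \<le> (4 / \<eta>) ^ (2 * q) * (1 / m ^ q)"
      using A B \<eta> m by (intro mult_mono) (auto intro!: less_imp_le[OF pochhammer_pos])
    finally have "pochhammer m q * R \<le> (4 / \<eta>) ^ (2 * q) / m ^ q" by simp
    then have "fact (2 * q) * (pochhammer m q * R) \<le> (2 * real q) ^ (2 * q) * ((4 / \<eta>) ^ (2 * q) / m ^ q)"
      using f R0 pochhammer_pos[OF m, of q] by (intro mult_mono) auto
    then show ?thesis by (simp add: mult_ac)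
  qed
  also have "\<dots> = 2 * ((8 * real q / \<eta>)\<^sup>2 / m) ^ q"
  proof -
    have "(2 * real q) ^ (2 * q) * ((4 / \<eta>) ^ (2 * q) / m ^ q) = ((2 * real q * (4 / \<eta>)) ^ 2) ^ q / m ^ q"
      unfolding power_mult[symmetric] power_mult_distrib by simp
    then show ?thesis by (simp add: power_divide power_mult_distrib)
  qed
  finally show ?thesis by (simp add: y_def N_def m_def)
qed

section \<open>The discrete arcsine law\<close>

text \<open>This is \<open>(2 * j choose j) / 4 ^ j\<close>, in the form that suits the urn recursion.\<close>

definition arcsine_coeff :: "nat \<Rightarrow> real" where
  "arcsine_coeff j = (\<Prod>i<j. (2 * real i + 1) / (2 * real i + 2))"

lemma arcsine_coeff_0 [simp]: "arcsine_coeff 0 = 1"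
  and arcsine_coeff_Suc: "arcsine_coeff (Suc j) = arcsine_coeff j * ((2 * real j + 1) / (2 * real j + 2))"
  by (simp_all add: arcsine_coeff_def)

lemma arcsine_coeff_nonneg: "0 \<le> arcsine_coeff j"
  by (simp add: arcsine_coeff_def prod_nonneg)

text \<open>The square of the coefficient times \<open>j + 1\<close> is decreasing in \<open>j\<close>.\<close>

lemma arcsine_coeff_le: "arcsine_coeff j \<le> 1 / sqrt (real j + 1)"
proof -
  have "(arcsine_coeff j)\<^sup>2 * (real j + 1) \<le> 1"
  proof (induction j)
    case (Suc j)
    have "((2 * real j + 1) / (2 * real j + 2))\<^sup>2 * (real j + 2) \<le> real j + 1"
      by (simp add: power_divide divide_simps) (simp add: power2_eq_square algebra_simps)
    then have "(arcsine_coeff j)\<^sup>2 * (((2 * real j + 1) / (2 * real j + 2))\<^sup>2 * (real j + 2)) \<le> (arcsine_coeff j)\<^sup>2 * (real j + 1)"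
      by (intro mult_left_mono) auto
    also have "\<dots> \<le> 1" by (rule Suc)
    finally show ?case unfolding arcsine_coeff_Suc power_mult_distrib by (simp add: mult_ac add_ac)
  qed simp
  then have "(arcsine_coeff j)\<^sup>2 \<le> (1 / sqrt (real j + 1))\<^sup>2"
    by (simp add: power_divide pos_le_divide_eq)
  then show ?thesis by (rule power2_le_imp_le) simp
qed

text \<open>The exact law is needed because the tail of order \<open>sqrt \<eta>\<close> at small relative sizes is sharp, while Markov's
  inequality with negative moments, which stay bounded only below order 1/2, loses in the exponent. The formula satisfies the one-step recursion since the products
  \<open>arcsine_coeff j * arcsine_coeff (m + 1 - j)\<close> receive the shares \<open>j / (m + 1)\<close> and
  \<open>(m + 1 - j) / (m + 1)\<close> from their two predecessors.\<close>

lemma prob_block_two: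
  assumes a: "a \<in> {1, 2}"
  shows "measure_pmf.prob (grow 2 m \<lparr>verts = {1, 2}, edges = {{1, 2}}\<rparr>) {T. card (block T 2 a) = Suc j} =
    (if j \<le> m then arcsine_coeff j * arcsine_coeff (m - j) else 0)"
proof (induction m arbitrary: j)
  case 0
  have "block \<lparr>verts = {1, 2}, edges = {{1, 2}}\<rparr> 2 a = {a}"
    using block_initial[OF rec_tree.two, of a] a by auto
  then show ?case by (simp add: indicator_def)
next
  case (Suc m)
  let ?T = "\<lparr>verts = {1, 2}, edges = {{1, 2}}\<rparr> :: nat ugraph"
  let ?P = "\<lambda>x. measure_pmf.prob (grow 2 m ?T) {T. card (block T 2 a) = x}"
  define N where "N = real m + 1"
  have "measure_pmf.prob (grow 2 (Suc m) ?T) {T. card (block T 2 a) = Suc j} =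
    measure_pmf.expectation (grow 2 m ?T) (\<lambda>T. (real j - 1 / 2) / N * indicator {T. card (block T 2 a) = j} T
      + (1 - (real j + 1 / 2) / N) * indicator {T. card (block T 2 a) = Suc j} T)"
    unfolding prob_eq_expectation
  proof (rule expectation_grow_Suc[OF rec_tree.two])
    fix T assume T: "rec_tree (2 + m) T"
    let ?c = "card (block T 2 a)"
    have mem: "i \<in> block T 2 a \<longleftrightarrow> anchor T 2 i = a" if "i \<in> {1..2 + m}" for i
      using that unfolding block_def rec_tree_verts[OF T] by blast
    have w: "weight T 2 a = real ?c - 1 / 2" using card_block_eq_weight[OF T a] by simp
    have "measure_pmf.expectation (degree_biased T)
        (\<lambda>i. indicator {T. card (block T 2 a) = Suc j} (attach_leaf T i (Suc (2 + m)))) =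
      measure_pmf.expectation (degree_biased T)
        (\<lambda>i. if i \<in> block T 2 a then indicator {?c} j else indicator {?c} (Suc j) :: real)"
    proof (rule expectation_cong_pmf)
      fix i assume "i \<in> set_pmf (degree_biased T)"
      then have i: "i \<in> {1..2 + m}" unfolding set_pmf_degree_biased[OF T] .
      show "indicator {T. card (block T 2 a) = Suc j} (attach_leaf T i (Suc (2 + m))) =
        (if i \<in> block T 2 a then indicator {?c} j else indicator {?c} (Suc j) :: real)"
        using card_block_attach[OF T i, of 2 a] mem[OF i] by (auto simp: indicator_def)
    qed
    also have "\<dots> = weight T 2 a / (real (2 + m) - 1) * indicator {?c} j
        + (1 - weight T 2 a / (real (2 + m) - 1)) * indicator {?c} (Suc j)"
    proof (rule expectation_degree_biased[OF T])
      show "block T 2 a \<subseteq> {1..2 + m}" unfolding block_def rec_tree_verts[OF T] by blast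
    qed (simp add: weight_def)
    also have "\<dots> = (real j - 1 / 2) / N * indicator {T. card (block T 2 a) = j} T
      + (1 - (real j + 1 / 2) / N) * indicator {T. card (block T 2 a) = Suc j} T"
      unfolding w N_def by (auto simp: indicator_def add.commute)
    finally show "measure_pmf.expectation (degree_biased T)
        (\<lambda>i. indicator {T. card (block T 2 a) = Suc j} (attach_leaf T i (Suc (2 + m)))) = \<dots>" .
  qed
  also have "\<dots> = (real j - 1 / 2) / N * ?P j + (1 - (real j + 1 / 2) / N) * ?P (Suc j)"
    using finite_set_pmf_grow[OF rec_tree.two]
    by (subst Bochner_Integration.integral_add) (auto intro!: integrable_measure_pmf_finite)
  also have "\<dots> = (if j \<le> Suc m then arcsine_coeff j * arcsine_coeff (Suc m - j) else 0)"
  proof (cases j)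
    case 0
    have "?P 0 = 0"
    proof -
      have "card (block T 2 a) \<noteq> 0" if "T \<in> set_pmf (grow 2 m ?T)" for T
      proof -
        have "real (card (block T 2 a)) = weight T 2 a + 1 / 2"
          by (rule card_block_eq_weight[OF rec_tree_grow[OF rec_tree.two that] a])
        then show ?thesis using weight_nonneg[of T 2 a] by auto
      qed
      then show ?thesis unfolding measure_pmf_zero_iff by blast
    qed
    then show ?thesis using 0 Suc.IH[of 0] by (simp add: N_def arcsine_coeff_Suc field_simps)
  next
    case (Suc i)
    consider "i < m" | "i = m" | "m < i" by linarith
    then show ?thesis
    proof cases
      case 1
      then obtain d where d: "m = Suc (i + d)" using less_iff_Suc_add by auto
      have rec: "(real r + 1 / 2) * arcsine_coeff r = (real r + 1) * arcsine_coeff (Suc r)" for r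
        by (simp add: arcsine_coeff_Suc field_simps)
      have P: "?P j = arcsine_coeff i * arcsine_coeff (Suc d)"
        "?P (Suc j) = arcsine_coeff d * arcsine_coeff (Suc i)"
        unfolding Suc Suc.IH using d by (simp_all add: Suc_diff_le)
      have N: "N = real i + real d + 2" by (simp add: N_def d)
      have "(real j - 1 / 2) / N * ?P j + (1 - (real j + 1 / 2) / N) * ?P (Suc j) =
        ((real i + 1 / 2) * arcsine_coeff i * arcsine_coeff (Suc d)
          + (real d + 1 / 2) * arcsine_coeff d * arcsine_coeff (Suc i)) / N"
      proof -
        have "real j - 1 / 2 = real i + 1 / 2" "1 - (real j + 1 / 2) / N = (real d + 1 / 2) / N"
          using Suc N by (simp_all add: field_simps)
        then show ?thesis unfolding P
          by (simp only: add_divide_distrib[symmetric] times_divide_eq_left mult.assoc)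
      qed
      also have "\<dots> = ((real i + 1) + (real d + 1)) * (arcsine_coeff (Suc i) * arcsine_coeff (Suc d)) / N"
        unfolding rec by (simp add: algebra_simps)
      also have "\<dots> = arcsine_coeff (Suc i) * arcsine_coeff (Suc d)" unfolding N by (simp add: field_simps)
      finally show ?thesis using Suc d by (simp del: grow.simps)
    next
      case 2
      then show ?thesis using Suc Suc.IH[of i] Suc.IH[of j]
        by (simp add: N_def arcsine_coeff_Suc field_simps)
    next
      case 3
      then show ?thesis using Suc Suc.IH[of i] Suc.IH[of j] by simp
    qed
  qed
  finally show ?case .
qed

lemma sum_inverse_sqrt_le: "(\<Sum>i<x. 1 / sqrt (real i + 1)) \<le> 2 * sqrt (real x)"
proof (induction x)
  case (Suc x)
  have "1 / sqrt (real x + 1) \<le> 2 * (sqrt (real x + 1) - sqrt (real x))"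
  proof -
    have "(sqrt (real x + 1) - sqrt (real x)) * (sqrt (real x + 1) + sqrt (real x)) = 1"
      by (simp add: algebra_simps)
    then have "sqrt (real x + 1) - sqrt (real x) = 1 / (sqrt (real x + 1) + sqrt (real x))"
      by (metis add_pos_nonneg nonzero_eq_divide_eq of_nat_0_le_iff order_less_irrefl real_sqrt_ge_zero real_sqrt_gt_zero zero_less_one add_nonneg_pos)
    moreover have "1 / (2 * sqrt (real x + 1)) \<le> 1 / (sqrt (real x + 1) + sqrt (real x))"
      by (intro divide_left_mono mult_pos_pos) (auto intro: add_pos_nonneg)
    ultimately show ?thesis by simp
  qed
  then show ?case using Suc by (simp add: add.commute)
qed simp

lemma prob_small_half:
  assumes a: "a \<in> {1, 2}" and m: "0 < m" "2 * x \<le> m"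
  shows "measure_pmf.prob (PA (2 + m)) {T. card (block T 2 a) \<le> x} \<le> 2 * sqrt (2 * real x / real m)"
proof -
  let ?T = "\<lparr>verts = {1, 2}, edges = {{1, 2}}\<rparr> :: nat ugraph"
  let ?p = "grow 2 m ?T"
  have pos: "card (block T 2 a) \<noteq> 0" if "T \<in> set_pmf ?p" for T
  proof -
    have "real (card (block T 2 a)) = weight T 2 a + 1 / 2"
      by (rule card_block_eq_weight[OF rec_tree_grow[OF rec_tree.two that] a])
    then show ?thesis using weight_nonneg[of T 2 a] by auto
  qed
  have "measure_pmf.prob ?p {T. card (block T 2 a) \<le> x} \<le> measure_pmf.prob ?p (\<Union>i<x. {T. card (block T 2 a) = Suc i})"
  proof (rule measure_pmf.finite_measure_mono_AE)
    show "AE T in measure_pmf ?p. T \<in> {T. card (block T 2 a) \<le> x} \<longrightarrow> T \<in> (\<Union>i<x. {T. card (block T 2 a) = Suc i})"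
      unfolding AE_measure_pmf_iff
    proof (intro ballI impI)
      fix T assume "T \<in> set_pmf ?p" "T \<in> {T. card (block T 2 a) \<le> x}"
      then have "card (block T 2 a) = Suc (card (block T 2 a) - 1)" "card (block T 2 a) - 1 < x"
        using pos[of T] by auto
      then show "T \<in> (\<Union>i<x. {T. card (block T 2 a) = Suc i})" by blast
    qed
  qed simp
  also have "\<dots> \<le> (\<Sum>i<x. measure_pmf.prob ?p {T. card (block T 2 a) = Suc i})"
    by (intro measure_pmf.finite_measure_subadditive_finite) auto
  also have "\<dots> \<le> (\<Sum>i<x. 1 / sqrt (real i + 1) * sqrt (2 / real m))"
  proof (rule sum_mono)
    fix i assume "i \<in> {..<x}"
    then have i: "i \<le> m" "real m / 2 \<le> real (m - i) + 1" using m by auto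
    have "arcsine_coeff (m - i) \<le> 1 / sqrt (real (m - i) + 1)" by (rule arcsine_coeff_le)
    also have "\<dots> \<le> 1 / sqrt (real m / 2)"
      using i m by (intro divide_left_mono mult_pos_pos) auto
    also have "\<dots> = sqrt (2 / real m)" by (simp add: real_sqrt_divide)
    finally have "arcsine_coeff i * arcsine_coeff (m - i) \<le> 1 / sqrt (real i + 1) * sqrt (2 / real m)"
      using arcsine_coeff_le[of i] by (intro mult_mono arcsine_coeff_nonneg) auto
    then show "measure_pmf.prob ?p {T. card (block T 2 a) = Suc i} \<le> 1 / sqrt (real i + 1) * sqrt (2 / real m)"
      unfolding prob_block_two[OF a] using i by simp
  qed
  also have "\<dots> = (\<Sum>i<x. 1 / sqrt (real i + 1)) * sqrt (2 / real m)"
    by (rule sum_distrib_right[symmetric])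
  also have "\<dots> \<le> 2 * sqrt (real x) * sqrt (2 / real m)"
    by (intro mult_right_mono sum_inverse_sqrt_le) simp
  also have "\<dots> = 2 * sqrt (2 * real x / real m)"
    by (simp add: real_sqrt_mult real_sqrt_divide mult_ac)
  finally show ?thesis using PA_eq_grow[of "2 + m"] by simp
qed

section \<open>Criteria for the root to be more central\<close>

text \<open>If no block reaches half of the tree, then everything below the root is smaller than half, while any
  other vertex sees more than half of the tree in the direction of the root.\<close>

lemma root_most_central_if_starlike:
  assumes T: "rec_tree n T" and M: "2 \<le> M" "M \<le> n" and star: "starlike T M"
    and light: "\<And>k. k \<in> {1..M} \<Longrightarrow> weight T M k < (real n - 1) / 2"
    and v: "v \<in> {2..n}"
  shows "psi T 1 < psi T v"
proof -
  have small: "2 * card (block T M k) < n" if "k \<in> {1..M}" for k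
  proof -
    have "real (2 * card (block T M k)) < real n"
      using card_block_le_weight[OF T M that] light[OF that] by (simp add: field_simps)
    then show ?thesis by simp
  qed
  obtain k where "k \<in> {1..M}" "psi T 1 \<le> card (block T M k)"
    using psi_root_upper_starlike[OF T _ star] M by auto
  moreover have "anchor T M v \<in> {1..M}" using anchor_range[OF T] M v by simp
  ultimately show ?thesis
    using small[of k] small[of "anchor T M v"] psi_lower_starlike[OF T star v] by linarith
qed

text \<open>Both sides are compared with \<open>n - x\<close>: the larger half is smaller than this, the complement of a block
  of size at most \<open>x\<close> is not.\<close>

lemma root_beats_late_vertices:
  assumes T: "rec_tree n T" and M: "2 \<le> M" "M \<le> n"
    and halves: "x < card (block T 2 1)" "x < card (block T 2 2)"
    and light: "\<And>k. k \<in> {1..M} \<Longrightarrow> weight T M k + 1 / 2 \<le> real x"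
    and v: "v \<in> {M<..n}"
  shows "psi T 1 < psi T v"
proof -
  have v': "v \<in> {1..n}" "M < v" using v M by auto
  have k: "anchor T M v \<in> {1..M}" using anchor_range[OF T] M v' by simp
  have "card (block T M (anchor T M v)) \<le> x"
    using card_block_le_weight[OF T M k] light[OF k] by linarith
  moreover have "n - card (block T M (anchor T M v)) \<le> psi T v"
    using psi_lower_late[OF T _ v'] M by simp
  moreover obtain j where j: "j \<in> {1..2}" "psi T 1 \<le> card (block T 2 j)"
    using psi_root_upper_starlike[OF T _ starlike_two[OF T]] by auto
  moreover have "j = 1 \<or> j = 2" using j by auto
  ultimately show ?thesis using halves card_blocks_two[OF T] by auto
qed

section \<open>A configuration that makes the root the centre\<close>

lemma exists_star:
  "2 \<le> n \<Longrightarrow> \<exists>T. rec_tree n T \<and> starlike T n \<and> degree T 1 = n - 1 \<and> (\<forall>v\<in>{2..n}. degree T v = 1)"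
proof (induction n rule: dec_induct)
  case base
  then show ?case using rec_tree.two starlike_two[OF rec_tree.two] degree_two
    by (intro exI[of _ "\<lparr>verts = {1, 2}, edges = {{1, 2}}\<rparr>"]) auto
next
  case (step n)
  then obtain T where T: "rec_tree n T" "starlike T n" "degree T 1 = n - 1" "\<forall>v\<in>{2..n}. degree T v = 1"
    by blast
  have i: "1 \<in> {1..n}" using step by simp
  let ?T = "attach_leaf T 1 (Suc n)"
  have "rec_tree (Suc n) ?T" by (rule rec_tree.attach[OF T(1) i])
  moreover have "starlike ?T (Suc n)" using T(2) by (auto simp: starlike_def le_Suc_eq)
  moreover have "degree ?T 1 = Suc n - 1" using degree_attach[OF T(1) i, of 1] T(3) step by simp
  moreover have "degree ?T v = 1" if "v \<in> {2..Suc n}" for v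
    using degree_attach[OF T(1) i, of v] T(4) that by (auto simp: le_Suc_eq)
  ultimately show ?case by blast
qed

text \<open>One leaf is added to each of the first \<open>l\<close> legs of a star. Lengthening the legs reduces the share
  of the root's own block from one half to about one quarter, which is what the second moment estimate
  needs.\<close>

lemma exists_spider:
  assumes L: "1 \<le> L"
  shows "l \<le> L \<Longrightarrow> \<exists>T. rec_tree (Suc L + l) T \<and> starlike T (Suc L) \<and> weight T (Suc L) 1 = real L / 2 \<and>
    (\<forall>k\<in>{2..Suc L}. weight T (Suc L) k = (if k \<le> Suc l then 3 / 2 else 1 / 2))"
proof (induction l)
  case 0
  obtain T where T: "rec_tree (Suc L) T" "starlike T (Suc L)" "degree T 1 = Suc L - 1"
      "\<forall>v\<in>{2..Suc L}. degree T v = 1"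
    using exists_star[of "Suc L"] L by auto
  then show ?case
    using weight_initial[OF T(1)] by (intro exI[of _ T]) auto
next
  case (Suc l)
  then obtain T where T: "rec_tree (Suc L + l) T" "starlike T (Suc L)" "weight T (Suc L) 1 = real L / 2"
      "\<forall>k\<in>{2..Suc L}. weight T (Suc L) k = (if k \<le> Suc l then 3 / 2 else 1 / 2)"
    by auto
  let ?T = "attach_leaf T (l + 2) (Suc (Suc L + l))"
  have i: "l + 2 \<in> {1..Suc L + l}" using Suc.prems by auto
  have w: "weight ?T (Suc L) k = weight T (Suc L) k + (if k = l + 2 then 1 else 0)" for k
    using weight_attach[OF T(1) i, of "Suc L" k] Suc.prems by auto
  have "rec_tree (Suc L + Suc l) ?T" using rec_tree.attach[OF T(1) i] by simp
  moreover have "starlike ?T (Suc L)" using T(2) by (auto simp: starlike_def)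
  moreover have "weight ?T (Suc L) 1 = real L / 2" using w[of 1] T(3) by simp
  moreover have "weight ?T (Suc L) k = (if k \<le> Suc (Suc l) then 3 / 2 else 1 / 2)" if "k \<in> {2..Suc L}" for k
    using w[of k] T(4) that by auto
  ultimately show ?case by blast
qed

lemma starlike_grow:
  assumes "starlike T M"
  shows "T' \<in> set_pmf (grow m j T) \<Longrightarrow> starlike T' M"
  using assms by (induction j arbitrary: T') (auto simp: set_bind_pmf starlike_def)

text \<open>With six legs the initial rising factorials of order two add up to \<open>12 + 6 * 15/4 = 69/2\<close>, and
  \<open>4 * (69/2) / (12 * 13) = 69/78 \<le> 9/10\<close>. So Markov's inequality at half of the total weight still leaves
  a positive probability for the event that all seven blocks are light.\<close>

lemma prob_root_most_central:
  "\<exists>\<delta>>0. \<forall>n\<ge>13. \<delta> \<le> measure_pmf.prob (PA n) {T. rec_tree n T \<and> (\<forall>v\<in>{2..n}. psi T 1 < psi T v)}"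
proof -
  obtain T0 where T0: "rec_tree 13 T0" "starlike T0 7" "weight T0 7 1 = 3"
      "\<forall>k\<in>{2..7}. weight T0 7 k = 3 / 2"
    using exists_spider[of 6 6] by (auto cong: if_cong)
  define \<delta> where "\<delta> = pmf (PA 13) T0 * (1 / 10)"
  have pos: "0 < pmf (PA 13) T0" using set_pmf_PA[of 13 T0] T0(1) by (simp add: pmf_positive)
  have "\<delta> \<le> measure_pmf.prob (PA n) {T. rec_tree n T \<and> (\<forall>v\<in>{2..n}. psi T 1 < psi T v)}" if n: "13 \<le> n" for n
  proof -
    let ?A = "{T. rec_tree n T \<and> (\<forall>v\<in>{2..n}. psi T 1 < psi T v)}"
    let ?heavy = "{T. \<exists>k\<in>{1..7}. (real n - 1) / 2 \<le> weight T 7 k}"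
    define p where "p = grow 13 (n - 13) T0"
    have eq: "13 + (n - 13) = n" using n by simp
    define N where "N = real n - 1"
    have N: "0 < N" using n by (simp add: N_def)
    have S: "(\<Sum>k=1..7. pochhammer (weight T0 7 k) 2) = 69 / 2"
    proof -
      have "(\<Sum>k=1..7. pochhammer (weight T0 7 k) 2) =
          pochhammer (weight T0 7 1) 2 + (\<Sum>k=2..7. pochhammer (weight T0 7 k) 2)"
        using sum.atLeast_Suc_atMost[of 1 7 "\<lambda>k. pochhammer (weight T0 7 k) 2"]
        by (simp add: numeral_2_eq_2 del: sum.cl_ivl_Suc)
      also have "(\<Sum>k=2..7. pochhammer (weight T0 7 k) 2) = (\<Sum>k=2..7::nat. 15 / 4)"
      proof (rule sum.cong[OF refl])
        fix k :: nat assume "k \<in> {2..7}"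
        then have w: "weight T0 7 k = 3 / 2" using T0(4) by blast
        show "pochhammer (weight T0 7 k) 2 = 15 / 4" unfolding w by (simp add: numeral_2_eq_2 pochhammer_Suc)
      qed
      finally show ?thesis using T0(3) by (simp add: numeral_2_eq_2 pochhammer_Suc)
    qed
    have "measure_pmf.prob p ?heavy \<le> (69 / 2) * (pochhammer N 2 / (pochhammer 12 2 * pochhammer (N / 2) 2))"
      using prob_heavy_block_grow[OF T0(1), of 7 "N / 2" "n - 13" 2] N unfolding eq S p_def N_def by simp
    also have "\<dots> = (69 / 2) * (N * (N + 1) / (156 * (N / 2 * (N / 2 + 1))))"
      by (simp add: numeral_2_eq_2 pochhammer_Suc)
    also have "\<dots> \<le> 9 / 10"
      using N by (simp add: divide_simps)
    finally have heavy: "measure_pmf.prob p ?heavy \<le> 9 / 10" .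
    have "1 / 10 \<le> measure_pmf.prob p (- ?heavy)"
      using heavy measure_pmf.prob_compl[of ?heavy p] by (simp add: Compl_eq_Diff_UNIV)
    also have "\<dots> \<le> measure_pmf.prob p ?A"
    proof (rule measure_pmf.finite_measure_mono_AE)
      show "AE T in measure_pmf p. T \<in> - ?heavy \<longrightarrow> T \<in> ?A"
        unfolding AE_measure_pmf_iff
      proof (intro ballI impI)
        fix T assume T: "T \<in> set_pmf p" "T \<in> - ?heavy"
        then have "rec_tree n T" using rec_tree_grow[OF T0(1), of T "n - 13"] unfolding p_def eq by blast
        moreover have "starlike T 7" using starlike_grow[OF T0(2)] T(1) unfolding p_def by blast
        ultimately show "T \<in> ?A"
          using root_most_central_if_starlike[of n T 7] T(2) n by (auto simp: not_le)
      qed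
    qed simp
    finally have A: "1 / 10 \<le> measure_pmf.prob p ?A" .
    have "\<delta> \<le> measure_pmf.expectation (PA 13) (\<lambda>T. measure_pmf.prob p ?A * indicator {T0} T)"
      using A pos by (simp add: \<delta>_def measure_pmf_single)
    also have "\<dots> \<le> measure_pmf.expectation (PA 13) (\<lambda>T. measure_pmf.prob (grow 13 (n - 13) T) ?A)"
      by (intro expectation_mono_pmf finite_set_pmf_PA) (auto simp: indicator_def p_def)
    also have "\<dots> = measure_pmf.prob (PA n) ?A"
      using expectation_PA_add[of 13 "n - 13" "indicator ?A"] unfolding eq by simp
    finally show ?thesis .
  qed
  then show ?thesis using pos by (intro exI[of _ \<delta>]) (auto simp: \<delta>_def)
qed

section \<open>Probability that the root is found\<close>

text \<open>The three unlikely events are that one of the two halves is at most \<open>\<eta> n\<close> (rounded up), each of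
  probability at most \<open>\<epsilon> / 4\<close>, and that one of the \<open>K\<close> blocks weighs at least \<open>\<eta> (n - 1) / 2\<close>. The factor
  1/2 in the latter absorbs the difference between size and weight.\<close>

lemma prob_root_beats_late_vertices:
  fixes \<epsilon> :: real
  assumes \<epsilon>: "0 < \<epsilon>" "\<epsilon> < 1" and q: "2 \<le> q" "4 / \<epsilon> \<le> 4 ^ q"
    and K: "2 \<le> K" "4 * (8 * real q / (\<epsilon>\<^sup>2 / 576))\<^sup>2 \<le> real K - 1"
  shows "\<forall>\<^sub>F n in sequentially.
    1 - \<epsilon> \<le> measure_pmf.prob (PA n) {T. rec_tree n T \<and> (\<forall>v\<in>{K<..n}. psi T 1 < psi T v)}"
proof -
  define \<eta> where "\<eta> = \<epsilon>\<^sup>2 / 576"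
  have \<epsilon>2: "0 < \<epsilon>\<^sup>2" "\<epsilon>\<^sup>2 \<le> 1" using \<epsilon> by (auto simp: power_le_one)
  have \<eta>: "0 < \<eta>" "\<eta> \<le> 1 / 576" using \<epsilon>2 by (auto simp: \<eta>_def)
  have "1 - \<epsilon> \<le> measure_pmf.prob (PA n) {T. rec_tree n T \<and> (\<forall>v\<in>{K<..n}. psi T 1 < psi T v)}"
    if n: "nat \<lceil>1 / \<eta>\<rceil> + K + 2 * q + 4 \<le> n" for n
  proof -
    let ?A = "{T. rec_tree n T \<and> (\<forall>v\<in>{K<..n}. psi T 1 < psi T v)}"
    have "1 / \<eta> \<le> real n" using n by linarith
    then have n1: "1 \<le> \<eta> * real n" using \<eta> by (simp add: field_simps)
    have nK: "K \<le> n" "2 * q \<le> n - 1" "4 \<le> n" using n by auto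
    define x where "x = nat \<lceil>\<eta> * real n\<rceil>"
    have x: "\<eta> * real n \<le> real x" "real x \<le> 2 * \<eta> * real n" using n1 unfolding x_def by linarith+
    define m where "m = n - 2"
    have m: "n = 2 + m" "0 < m" "real n \<le> 2 * real m" using nK by (auto simp: m_def)
    have "\<eta> * real n \<le> (1 / 576) * real n" using \<eta> by (intro mult_right_mono) auto
    then have "2 * real x \<le> real m" using x m by linarith
    then have xm: "2 * x \<le> m" by linarith
    let ?S = "\<lambda>a. {T. card (block T 2 a) \<le> x}"
    let ?H = "{T. \<exists>k\<in>{1..K}. \<eta> * (real n - 1) / 2 \<le> weight T K k}"
    have S: "measure_pmf.prob (PA n) (?S a) \<le> \<epsilon> / 4" if "a \<in> {1, 2}" for a
    proof -
      have "2 * real x / real m \<le> 8 * \<eta>"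
      proof -
        have "real n * \<eta> \<le> 2 * real m * \<eta>" using m \<eta> by (intro mult_right_mono) auto
        then have "2 * real x \<le> 8 * \<eta> * real m" using x by (simp add: mult_ac)
        then show ?thesis using m by (simp add: pos_divide_le_eq)
      qed
      also have "\<dots> \<le> (\<epsilon> / 8)\<^sup>2" using \<epsilon>2 by (simp add: \<eta>_def power_divide)
      finally have "sqrt (2 * real x / real m) \<le> \<epsilon> / 8" using \<epsilon> by (intro real_le_lsqrt) auto
      then show ?thesis using prob_small_half[OF that m(2) xm] m(1) by simp
    qed
    have H: "measure_pmf.prob (PA n) ?H \<le> \<epsilon> / 2"
    proof -
      define y where "y = (8 * real q / \<eta>)\<^sup>2 / (real K - 1)"
      have K1: "0 < real K - 1" using K(1) by simp
      have "y \<le> 1 / 4" using K(2) K1 unfolding y_def by (simp add: pos_divide_le_eq flip: \<eta>_def)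
      moreover have "0 \<le> y" using K1 by (simp add: y_def)
      ultimately have "y ^ q \<le> (1 / 4) ^ q" by (intro power_mono)
      also have "\<dots> \<le> \<epsilon> / 4" using q(2) \<epsilon> by (simp add: power_divide field_simps)
      finally show ?thesis
        using prob_heavy_block_PA[OF K(1) nK(1) q(1) nK(2) \<eta>(1)] unfolding y_def by simp
    qed
    have "AE T in measure_pmf (PA n). T \<in> - (?S 1 \<union> ?S 2 \<union> ?H) \<longrightarrow> T \<in> ?A"
      unfolding AE_measure_pmf_iff
    proof (intro ballI impI)
      fix T assume "T \<in> set_pmf (PA n)" and T': "T \<in> - (?S 1 \<union> ?S 2 \<union> ?H)"
      then have T: "rec_tree n T" using set_pmf_PA nK by simp
      have "weight T K k + 1 / 2 \<le> real x" if "k \<in> {1..K}" for k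
      proof -
        have "weight T K k < \<eta> * (real n - 1) / 2" using T' that by (auto simp: not_le)
        then show ?thesis using x(1) n1 \<eta> by (simp add: algebra_simps)
      qed
      then show "T \<in> ?A" using T T' root_beats_late_vertices[OF T K(1) nK(1), of x] by auto
    qed
    then have "measure_pmf.prob (PA n) (- (?S 1 \<union> ?S 2 \<union> ?H)) \<le> measure_pmf.prob (PA n) ?A"
      by (intro measure_pmf.finite_measure_mono_AE) auto
    moreover have "measure_pmf.prob (PA n) (- (?S 1 \<union> ?S 2 \<union> ?H)) = 1 - measure_pmf.prob (PA n) (?S 1 \<union> ?S 2 \<union> ?H)"
      using measure_pmf.prob_compl[of "?S 1 \<union> ?S 2 \<union> ?H" "PA n"] by (simp add: Compl_eq_Diff_UNIV)
    moreover have "measure_pmf.prob (PA n) (?S 1 \<union> ?S 2 \<union> ?H) \<le>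
        measure_pmf.prob (PA n) (?S 1) + measure_pmf.prob (PA n) (?S 2) + measure_pmf.prob (PA n) ?H"
      using measure_Un_le[of "?S 1 \<union> ?S 2" "measure_pmf (PA n)" ?H] measure_Un_le[of "?S 1" "measure_pmf (PA n)" "?S 2"]
      by simp
    ultimately show ?thesis using S[of 1] S[of 2] H by simp
  qed
  then show ?thesis unfolding eventually_sequentially by blast
qed

lemma prob_root_selected:
  assumes naming: "vertex_naming rep name" and H: "is_H_psi K rep H" and K: "1 \<le> M" "M \<le> K"
    and ev: "\<forall>\<^sub>F n in sequentially.
      c \<le> measure_pmf.prob (PA n) {T. rec_tree n T \<and> (\<forall>v\<in>{M<..n}. psi T 1 < psi T v)}"
  shows "ereal c \<le> liminf (\<lambda>n. ereal (measure_pmf.prob (PA n) {T. name T 1 \<in> H (unlabeled T)}))"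
proof (rule Liminf_bounded)
  show "\<forall>\<^sub>F n in sequentially. ereal c \<le> ereal (measure_pmf.prob (PA n) {T. name T 1 \<in> H (unlabeled T)})"
    using ev eventually_ge_at_top[of K]
  proof eventually_elim
    case (elim n)
    have "name T 1 \<in> H (unlabeled T)"
      if T: "rec_tree n T" and less: "\<forall>v\<in>{M<..n}. psi T 1 < psi T v" for T
    proof (rule root_selected[OF naming H rec_tree_tree[OF T]])
      note V = rec_tree_verts[OF T]
      show "K \<le> card (verts T)" "1 \<in> verts T" using V elim rec_tree_ge2[OF T] by simp_all
      show "finite {2..M}" "card {2..M} < K" using K by auto
      show "psi T 1 < psi T v" if "v \<in> verts T" "v \<notin> insert 1 {2..M}" for v
        using less that V by auto
    qed
    then have "measure_pmf.prob (PA n) {T. rec_tree n T \<and> (\<forall>v\<in>{M<..n}. psi T 1 < psi T v)} \<le>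
      measure_pmf.prob (PA n) {T. name T 1 \<in> H (unlabeled T)}"
      by (intro measure_pmf.finite_measure_mono) auto
    then show ?case using elim by simp
  qed
qed

theorem theorem6:
  shows "\<exists>C::real. C > 0 \<and>
    (\<forall>\<epsilon>::real. \<forall>K::nat. \<forall>rep name H.
       0 < \<epsilon> \<and> \<epsilon> < 1 \<and> K > 0 \<and> real K \<ge> C * (ln (1 / \<epsilon>))\<^sup>2 / \<epsilon> ^ 4 \<and>
       vertex_naming rep name \<and> is_H_psi K rep H \<longrightarrow>
       liminf (\<lambda>n. ereal (measure_pmf.prob (PA n) {T. name T 1 \<in> H (unlabeled T)}))
         \<ge> ereal (1 - \<epsilon>))"
proof -
  \<comment> \<open>For \<open>\<epsilon> \<ge> 1 - \<delta>\<close> the probability \<open>\<delta>\<close> of a unique most central root is enough.\<close>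
  obtain \<delta>0 where \<delta>0: "0 < \<delta>0"
    "\<And>n. 13 \<le> n \<Longrightarrow> \<delta>0 \<le> measure_pmf.prob (PA n) {T. rec_tree n T \<and> (\<forall>v\<in>{2..n}. psi T 1 < psi T v)}"
    using prob_root_most_central by blast
  define \<delta> where "\<delta> = min \<delta>0 (1 / 2)"
  have \<delta>: "0 < \<delta>" "\<delta> < 1" "\<delta> \<le> \<delta>0" using \<delta>0 by (auto simp: \<delta>_def)
  define l0 where "l0 = ln (1 / (1 - \<delta>))"
  have l0: "0 < l0" using \<delta> by (simp add: l0_def)
  define B where "B = 1 + 3 / l0"
  have B: "0 < B" using l0 by (simp add: B_def add_pos_pos)
  \<comment> \<open>When \<open>1 - \<epsilon> > \<delta>\<close>, the logarithm \<open>L = ln (1 / \<epsilon>)\<close> exceeds \<open>l0\<close>, so \<open>q \<le> L + 3 \<le> B * L\<close>. The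
    constant is chosen such that \<open>8 * z\<^sup>2 \<le> K\<close> for the ratio \<open>z = 8 * q / \<eta>\<close> of the moment bound.\<close>
  define C where "C = 8 * (4608 * B)\<^sup>2"
  have "ereal (1 - \<epsilon>) \<le> liminf (\<lambda>n. ereal (measure_pmf.prob (PA n) {T. name T 1 \<in> H (unlabeled T)}))"
    if \<epsilon>: "0 < \<epsilon>" "\<epsilon> < 1" and K: "0 < K" "C * (ln (1 / \<epsilon>))\<^sup>2 / \<epsilon> ^ 4 \<le> real K"
      and H: "vertex_naming rep name" "is_H_psi K rep H"
    for \<epsilon> :: real and K :: nat and rep name H
  proof (cases "1 - \<epsilon> \<le> \<delta>")
    case True
    have "1 - \<epsilon> \<le> measure_pmf.prob (PA n) {T. rec_tree n T \<and> (\<forall>v\<in>{1<..n}. psi T 1 < psi T v)}"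
      if "13 \<le> n" for n
    proof -
      have "{1<..n} = {2..n}" by auto
      then show ?thesis using \<delta>0(2)[OF that] True \<delta>(3) by simp
    qed
    then have "\<forall>\<^sub>F n in sequentially.
      1 - \<epsilon> \<le> measure_pmf.prob (PA n) {T. rec_tree n T \<and> (\<forall>v\<in>{1<..n}. psi T 1 < psi T v)}"
      unfolding eventually_sequentially by blast
    then show ?thesis using K by (intro prob_root_selected[OF H, of 1]) auto
  next
    case False
    define L where "L = ln (1 / \<epsilon>)"
    \<comment> \<open>The summand 2 yields \<open>4 ^ q \<ge> exp (L + 2) \<ge> 4 / \<epsilon>\<close>.\<close>
    define q where "q = nat \<lceil>L\<rceil> + 2"
    have L: "l0 \<le> L" unfolding L_def l0_def using False \<epsilon> \<delta> by (subst ln_le_cancel_iff) (auto simp: field_simps)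
    then have "3 \<le> 3 / l0 * L" using l0 by (simp add: field_simps)
    then have "L + 3 \<le> B * L" unfolding B_def by (simp add: algebra_simps)
    moreover have qL: "L + 2 \<le> real q" "real q \<le> L + 3" unfolding q_def using L l0 by linarith+
    ultimately have qB: "real q \<le> B * L" by simp
    have q: "2 \<le> q" by (simp add: q_def)
    have q4: "4 / \<epsilon> \<le> 4 ^ q"
    proof -
      have e: "2 \<le> exp (1 :: real)" using exp_ge_add_one_self[of 1] by simp
      have "4 / \<epsilon> \<le> exp 1 * exp 1 * exp L"
        using mult_mono[OF e e] \<epsilon> by (simp add: L_def exp_minus ln_div divide_simps)
      also have "\<dots> = exp (L + 2)" by (simp flip: exp_add)
      also have "\<dots> \<le> exp (real q * 1)" using qL by simp
      also have "\<dots> = exp 1 ^ q" by (rule exp_of_nat_mult)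
      also have "\<dots> \<le> 4 ^ q" using exp_le by (intro power_mono) auto
      finally show ?thesis .
    qed
    define z where "z = 8 * real q / (\<epsilon>\<^sup>2 / 576)"
    have z: "z = 4608 * real q / \<epsilon>\<^sup>2" by (simp add: z_def)
    have "z \<le> 4608 * (B * L) / \<epsilon>\<^sup>2" unfolding z using qB by (intro divide_right_mono mult_left_mono) auto
    then have "z\<^sup>2 \<le> (4608 * (B * L) / \<epsilon>\<^sup>2)\<^sup>2" unfolding z by (intro power_mono) auto
    then have "8 * z\<^sup>2 \<le> C * L\<^sup>2 / \<epsilon> ^ 4"
      by (simp add: C_def power_divide power_mult_distrib flip: power_mult)
    then have zK: "8 * z\<^sup>2 \<le> real K" using K(2) unfolding L_def by simp
    have "1 \<le> z"
    proof -
      have "1 \<le> 1 / \<epsilon>\<^sup>2" using \<epsilon> by (simp add: power_le_one)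
      then show ?thesis unfolding z using mult_mono[of 1 "4608 * real q" 1 "1 / \<epsilon>\<^sup>2"] q by simp
    qed
    then have "1 \<le> z\<^sup>2" by simp
    then have "2 \<le> K" "4 * z\<^sup>2 \<le> real K - 1" using zK by linarith+
    then have "\<forall>\<^sub>F n in sequentially.
      1 - \<epsilon> \<le> measure_pmf.prob (PA n) {T. rec_tree n T \<and> (\<forall>v\<in>{K<..n}. psi T 1 < psi T v)}"
      unfolding z_def by (intro prob_root_beats_late_vertices[OF \<epsilon> q q4])
    then show ?thesis using K by (intro prob_root_selected[OF H, of K]) auto
  qed
  moreover have "0 < C" using B by (simp add: C_def)
  ultimately show ?thesis by (intro exI[of _ C]) blast
qed

end
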